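(* In the setting described in the context, assume condition $(\mathtt{A})$ holds with parameter $\delta\in\,]0,1/2[$, set $g:=e^{\delta U}$, $h:=e^{\delta V}$, and let $a>0$ and $\varrho\in\,]0,1[$ be such that $$\mathrm{lip}_{g_a,h_a}(\mathcal{K}_{2n})\vee\mathrm{lip}_{h_a,g_a}(\mathcal{K}_{2n+1})\le\varrho\quad\text{for all }n\ge1,\qquad g_a:=\tfrac12+a\,g,\; h_a:=\tfrac12+a\,h$$ (such $a,\varrho$ exist under $(\mathtt{A})$). Assume there exist semi-distances $\psi_g$ on $\mathbb{X}$ and $\psi_h$ on $\mathbb{Y}$ such that $$\psi_g(x_1,x_2)\le g(x_1)+g(x_2)\quad\text{and}\quad\psi_h(y_1,y_2)\le h(y_1)+h(y_2)$$ for all $x_1,x_2\in\mathbb{X}$, $y_1,y_2\in\mathbb{Y}$. Then there exists a constant $c>0$ such that for any $n\ge1$, $$D_{\psi_g}(\pi_{2n+1},\mu)\vee D_{\psi_h}(\pi_{2(n+1)},\eta)\le (c/a)\,\varrho^{2n}.$$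
   Context: Setting. $(\mathbb{X},\lambda)$ and $(\mathbb{Y},\nu)$ are locally compact Polish spaces with locally bounded positive measures. For a function $F$ on $\mathbb{X}$ (resp. $\mathbb{Y}$) write $\lambda_F(dx)=e^{-F(x)}\lambda(dx)$ (resp. $\nu_F(dy)=e^{-F(y)}\nu(dy)$). $\mu=\lambda_U$ and $\eta=\nu_V$ are probability measures, and $K(x,dy)=e^{-W(x,y)}\nu(dy)$ is a Markov transition from $\mathbb{X}$ to $\mathbb{Y}$. Standing assumptions: $U,V,W$ are real valued and locally bounded, $\sup e^{-W}<\infty$, and $U,V$ have compact sub-level sets. Put $W^V(x):=\int\nu_V(dy)W(x,y)$, $W_U(y):=\int\lambda_U(dx)W(x,y)$, $\mathcal{U}_\delta:=\delta U-W^V$, $\mathcal{V}_\delta:=\delta V-W_U$. $\mathcal{B}_0(\mathbb{X})$ is the set of bounded positive functions $\theta$ on $\mathbb{X}$ that are locally lower bounded (away from zero) and vanish at infinity, i.e. for any $0<\epsilon<\Vert\theta\Vert:=\sup\theta$ the set $\{\theta\ge\epsilon\}$ is non-empty and compact; likewise $\mathcal{B}_0(\mathbb{Y})$. Condition $(\mathtt{A})$: there exist $\delta\in\,]0,1/2[$ and $(\theta_u,\theta_v)\in\mathcal{B}_0(\mathbb{X})\times\mathcal{B}_0(\mathbb{Y})$ such that $\lambda_{(1-2\delta)U}(1)\vee\nu_{(1-2\delta)V}(1)<\infty$, $e^{-\mathcal{U}_\delta}\le\theta_u$ and $e^{-\mathcal{V}_\delta}\le\theta_v$. Sinkhorn transitions.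 Let $K(f)(x)=\int e^{-W(x,y)}f(y)\nu(dy)$ and $K^\flat(f)(y)=\int e^{-W(x,y)}f(x)\lambda(dx)$. Let $(U_0,V_0)=(U,0)$ and, for $n\ge0$, $U_{2n+1}=U_{2n}$, $V_{2n+1}=V+\log K^\flat(e^{-U_{2n}})$, $U_{2(n+1)}=U+\log K(e^{-V_{2n+1}})$, $V_{2(n+1)}=V_{2n+1}$. Then $$\mathcal{K}_{2n}(x,dy)=\frac{e^{-W(x,y)-V_{2n}(y)}\nu(dy)}{K(e^{-V_{2n}})(x)},\qquad \mathcal{K}_{2n+1}(y,dx)=\frac{e^{-W(x,y)-U_{2n+1}(x)}\lambda(dx)}{K^\flat(e^{-U_{2n+1}})(y)},$$ $\pi_{2n}:=\mu\mathcal{K}_{2n}$, $\pi_{2n+1}:=\eta\mathcal{K}_{2n+1}$. Semi-distances. A semi-distance $\psi$ is a lower semicontinuous function satisfying the axioms of a distance (nonnegative, symmetric, $\psi(x_1,x_2)=0$ iff $x_1=x_2$) except that the triangle inequality may fail. $D_\psi(\mu_1,\mu_2):=\inf_{Q\in\Pi(\mu_1,\mu_2)}\int\psi\,dQ$, where $\Pi(\mu_1,\mu_2)$ is the set of couplings of $\mu_1,\mu_2$. Norms. For a bounded signed measure $m$ and $g>0$ bounded away from zero, $|||m|||_g:=|m|(g)$ with $|m|$ the total variation measure; $\mathrm{Prob}_g$ is the set of probability measures $m$ with $m(g)<\infty$. For a Markov transition $L$ and positive functions $g$ (on the source) and $h$ (on the target) bounded away from zero, $\mathrm{lip}_{g,h}(L):=\sup\frac{|||\mu_1L-\mu_2L|||_h}{|||\mu_1-\mu_2|||_g}$,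 supremum over $\mu_1\ne\mu_2$ in $\mathrm{Prob}_g$. $a\vee b=\max(a,b)$. *)

theory Defs
  imports "HOL-Probability.Probability"
begin

section \<open>Gibbs measures and the standing assumptions\<close>

definition locally_bounded :: "('a::topological_space \<Rightarrow> real) \<Rightarrow> bool" where
  "locally_bounded f \<longleftrightarrow> (\<forall>x. \<exists>S. open S \<and> x \<in> S \<and> bounded (f ` S))"

definition locally_bounded_measure :: "'a::topological_space measure \<Rightarrow> bool" where
  "locally_bounded_measure M \<longleftrightarrow>
     sets M = sets borel \<and> (\<forall>x. \<exists>S. open S \<and> x \<in> S \<and> emeasure M S < \<infinity>)"

definition gibbs :: "'a measure \<Rightarrow> ('a \<Rightarrow> real) \<Rightarrow> 'a measure" where
  "gibbs M F = density M (\<lambda>x. ennreal (exp (- F x)))"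

text \<open>
  Borel measurability of \<open>U\<close> and \<open>V\<close> is not listed: a function with compact sub-level sets is lower
  semicontinuous.  The last assumption says that \<open>exp (- W x y) \<nu>(dy)\<close> is a Markov transition.
\<close>

locale sinkhorn_setting =
  fixes lam :: "'a::polish_space measure" and nu :: "'b::polish_space measure"
    and U :: "'a \<Rightarrow> real" and V :: "'b \<Rightarrow> real" and W :: "'a \<Rightarrow> 'b \<Rightarrow> real"
  assumes locally_compact_X: "locally_compact_space (euclidean :: 'a topology)"
    and locally_compact_Y: "locally_compact_space (euclidean :: 'b topology)"
    and lam: "locally_bounded_measure lam"
    and nu: "locally_bounded_measure nu"
    and U_locally_bounded: "locally_bounded U"
    and V_locally_bounded: "locally_bounded V"
    and W_locally_bounded: "locally_bounded (\<lambda>z. W (fst z) (snd z))"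
    and W_measurable: "(\<lambda>z. W (fst z) (snd z)) \<in> borel_measurable borel"
    and exp_W_bounded: "bdd_above (range (\<lambda>z. exp (- W (fst z) (snd z))))"
    and U_compact_sublevel: "\<And>r. compact {x. U x \<le> r}"
    and V_compact_sublevel: "\<And>r. compact {y. V y \<le> r}"
    and prob_mu: "prob_space (gibbs lam U)"
    and prob_eta: "prob_space (gibbs nu V)"
    and markov: "\<And>x. prob_space (gibbs nu (W x))"

section \<open>Condition (A)\<close>

definition B0 :: "('a::topological_space \<Rightarrow> real) set" where
  "B0 = {\<theta>. bounded (range \<theta>) \<and> (\<forall>x. 0 < \<theta> x) \<and>
     (\<forall>x. \<exists>S e. open S \<and> x \<in> S \<and> 0 < e \<and> (\<forall>y\<in>S. e \<le> \<theta> y)) \<and>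
     (\<forall>e. 0 < e \<and> e < (SUP x. \<theta> x) \<longrightarrow> {x. e \<le> \<theta> x} \<noteq> {} \<and> compact {x. e \<le> \<theta> x})}"

definition mean_Y :: "'b measure \<Rightarrow> ('b \<Rightarrow> real) \<Rightarrow> ('a \<Rightarrow> 'b \<Rightarrow> real) \<Rightarrow> 'a \<Rightarrow> real" where
  "mean_Y nu V W x = (\<integral>y. W x y \<partial>gibbs nu V)"

definition mean_X :: "'a measure \<Rightarrow> ('a \<Rightarrow> real) \<Rightarrow> ('a \<Rightarrow> 'b \<Rightarrow> real) \<Rightarrow> 'b \<Rightarrow> real" where
  "mean_X lam U W y = (\<integral>x. W x y \<partial>gibbs lam U)"

text \<open>
  As \<open>W\<close> is bounded below, \<open>W\<^sup>V(x)\<close> and \<open>W\<^sub>U(y)\<close> always exist in \<open>(-\<infinity>, \<infinity>]\<close>, and the bounds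
  by the real-valued \<open>\<theta>u\<close>, \<open>\<theta>v\<close> force them to be finite.  The Bochner integral of a
  non-integrable function is 0, so this finiteness has to be spelled out as integrability.
\<close>

definition condition_A ::
  "'a::polish_space measure \<Rightarrow> 'b::polish_space measure \<Rightarrow> ('a \<Rightarrow> real) \<Rightarrow> ('b \<Rightarrow> real) \<Rightarrow>
     ('a \<Rightarrow> 'b \<Rightarrow> real) \<Rightarrow> real \<Rightarrow> bool" where
  "condition_A lam nu U V W \<delta> \<longleftrightarrow> 0 < \<delta> \<and> \<delta> < 1/2 \<and>
     (\<forall>x. integrable (gibbs nu V) (\<lambda>y. W x y)) \<and>
     (\<forall>y. integrable (gibbs lam U) (\<lambda>x. W x y)) \<and>
     (\<exists>\<theta>u\<in>B0. \<exists>\<theta>v\<in>B0.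
        max (emeasure (gibbs lam (\<lambda>x. (1 - 2 * \<delta>) * U x)) UNIV)
            (emeasure (gibbs nu (\<lambda>y. (1 - 2 * \<delta>) * V y)) UNIV) < \<infinity> \<and>
        (\<forall>x. exp (- (\<delta> * U x - mean_Y nu V W x)) \<le> \<theta>u x) \<and>
        (\<forall>y. exp (- (\<delta> * V y - mean_X lam U W y)) \<le> \<theta>v y))"

section \<open>Sinkhorn transitions\<close>

text \<open>
  The operators \<open>K\<close> and \<open>K\<^sup>\<flat>\<close>.  Under condition (A) all the integrals used below are positive and
  finite.
\<close>

definition K_op :: "'b measure \<Rightarrow> ('a \<Rightarrow> 'b \<Rightarrow> real) \<Rightarrow> ('b \<Rightarrow> real) \<Rightarrow> 'a \<Rightarrow> real" where
  "K_op nu W f x = (\<integral>y. exp (- W x y) * f y \<partial>nu)"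

definition K_flat :: "'a measure \<Rightarrow> ('a \<Rightarrow> 'b \<Rightarrow> real) \<Rightarrow> ('a \<Rightarrow> real) \<Rightarrow> 'b \<Rightarrow> real" where
  "K_flat lam W f y = (\<integral>x. exp (- W x y) * f x \<partial>lam)"

primrec sinkhorn_potentials ::
  "'a measure \<Rightarrow> 'b measure \<Rightarrow> ('a \<Rightarrow> real) \<Rightarrow> ('b \<Rightarrow> real) \<Rightarrow> ('a \<Rightarrow> 'b \<Rightarrow> real) \<Rightarrow> nat \<Rightarrow>
     ('a \<Rightarrow> real) \<times> ('b \<Rightarrow> real)" where
  "sinkhorn_potentials lam nu U V W 0 = (U, \<lambda>_. 0)"
| "sinkhorn_potentials lam nu U V W (Suc m) =
     (let (Um, Vm) = sinkhorn_potentials lam nu U V W m in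
      if even m then (Um, \<lambda>y. V y + ln (K_flat lam W (\<lambda>x. exp (- Um x)) y))
      else (\<lambda>x. U x + ln (K_op nu W (\<lambda>y. exp (- Vm y)) x), Vm))"

definition sinkhorn_U ::
  "'a measure \<Rightarrow> 'b measure \<Rightarrow> ('a \<Rightarrow> real) \<Rightarrow> ('b \<Rightarrow> real) \<Rightarrow> ('a \<Rightarrow> 'b \<Rightarrow> real) \<Rightarrow> nat \<Rightarrow>
     'a \<Rightarrow> real" where
  "sinkhorn_U lam nu U V W m = fst (sinkhorn_potentials lam nu U V W m)"

definition sinkhorn_V ::
  "'a measure \<Rightarrow> 'b measure \<Rightarrow> ('a \<Rightarrow> real) \<Rightarrow> ('b \<Rightarrow> real) \<Rightarrow> ('a \<Rightarrow> 'b \<Rightarrow> real) \<Rightarrow> nat \<Rightarrow>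
     'b \<Rightarrow> real" where
  "sinkhorn_V lam nu U V W m = snd (sinkhorn_potentials lam nu U V W m)"

text \<open>
  The transition \<open>\<K>\<^sub>m\<close> goes from \<open>X\<close> to \<open>Y\<close> for even \<open>m\<close> and from \<open>Y\<close> to \<open>X\<close> for odd \<open>m\<close>.
  The formulas for the two types are given for every \<open>m\<close>; the first one is meant for even \<open>m\<close> and
  the second one for odd \<open>m\<close>.
\<close>

definition trans_even ::
  "'a measure \<Rightarrow> 'b measure \<Rightarrow> ('a \<Rightarrow> real) \<Rightarrow> ('b \<Rightarrow> real) \<Rightarrow> ('a \<Rightarrow> 'b \<Rightarrow> real) \<Rightarrow> nat \<Rightarrow>
     'a \<Rightarrow> 'b measure" where
  "trans_even lam nu U V W m x =
     (let Vm = sinkhorn_V lam nu U V W m in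
      density nu (\<lambda>y. ennreal (exp (- W x y - Vm y) / K_op nu W (\<lambda>y'. exp (- Vm y')) x)))"

definition trans_odd ::
  "'a measure \<Rightarrow> 'b measure \<Rightarrow> ('a \<Rightarrow> real) \<Rightarrow> ('b \<Rightarrow> real) \<Rightarrow> ('a \<Rightarrow> 'b \<Rightarrow> real) \<Rightarrow> nat \<Rightarrow>
     'b \<Rightarrow> 'a measure" where
  "trans_odd lam nu U V W m y =
     (let Um = sinkhorn_U lam nu U V W m in
      density lam (\<lambda>x. ennreal (exp (- W x y - Um x) / K_flat lam W (\<lambda>x'. exp (- Um x')) y)))"

definition pi_even ::
  "'a measure \<Rightarrow> 'b measure \<Rightarrow> ('a \<Rightarrow> real) \<Rightarrow> ('b \<Rightarrow> real) \<Rightarrow> ('a \<Rightarrow> 'b \<Rightarrow> real) \<Rightarrow> nat \<Rightarrow>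
     'b measure" where
  "pi_even lam nu U V W m = gibbs lam U \<bind> trans_even lam nu U V W m"

definition pi_odd ::
  "'a measure \<Rightarrow> 'b measure \<Rightarrow> ('a \<Rightarrow> real) \<Rightarrow> ('b \<Rightarrow> real) \<Rightarrow> ('a \<Rightarrow> 'b \<Rightarrow> real) \<Rightarrow> nat \<Rightarrow>
     'a measure" where
  "pi_odd lam nu U V W m = gibbs nu V \<bind> trans_odd lam nu U V W m"

section \<open>Semi-distances and transport costs\<close>

definition semi_distance :: "('a::topological_space \<Rightarrow> 'a \<Rightarrow> real) \<Rightarrow> bool" where
  "semi_distance \<psi> \<longleftrightarrow>
     (\<forall>r. closed {z. \<psi> (fst z) (snd z) \<le> r}) \<comment> \<open>lower semicontinuity on the product space\<close> \<and>
     (\<forall>x y. 0 \<le> \<psi> x y) \<and> (\<forall>x y. \<psi> x y = \<psi> y x) \<and> (\<forall>x y. \<psi> x y = 0 \<longleftrightarrow> x = y)"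

definition couplings :: "'a measure \<Rightarrow> 'b measure \<Rightarrow> ('a \<times> 'b) measure set" where
  "couplings M N = {Q. sets Q = sets (M \<Otimes>\<^sub>M N) \<and> distr Q M fst = M \<and> distr Q N snd = N}"

definition transport_cost ::
  "('a \<Rightarrow> 'a \<Rightarrow> real) \<Rightarrow> 'a measure \<Rightarrow> 'a measure \<Rightarrow> ennreal" where
  "transport_cost \<psi> M N = (INF Q\<in>couplings M N. \<integral>\<^sup>+ z. ennreal (\<psi> (fst z) (snd z)) \<partial>Q)"

section \<open>Weighted total variation norms and Lipschitz constants\<close>

text \<open>
  A bounded signed measure is represented by its set function \<open>m\<close> on the measurable sets of
  \<open>M\<close>; only the measurable space of \<open>M\<close> matters.
\<close>

definition tv_measure :: "'a measure \<Rightarrow> ('a set \<Rightarrow> real) \<Rightarrow> 'a measure" where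
  "tv_measure M m = measure_of (space M) (sets M)
     (\<lambda>A. SUP P\<in>{P. finite P \<and> disjoint P \<and> P \<subseteq> sets M \<and> \<Union>P = A}. \<Sum>B\<in>P. ennreal \<bar>m B\<bar>)"

definition weighted_norm :: "('a::topological_space \<Rightarrow> real) \<Rightarrow> ('a set \<Rightarrow> real) \<Rightarrow> ennreal" where
  "weighted_norm g m = (\<integral>\<^sup>+ x. ennreal (g x) \<partial>tv_measure borel m)"

definition Prob_wt :: "('a::topological_space \<Rightarrow> real) \<Rightarrow> 'a measure set" where
  "Prob_wt g = {M. sets M = sets borel \<and> prob_space M \<and> (\<integral>\<^sup>+ x. ennreal (g x) \<partial>M) < \<infinity>}"

definition lip ::
  "('a::topological_space \<Rightarrow> real) \<Rightarrow> ('b::topological_space \<Rightarrow> real) \<Rightarrow> ('a \<Rightarrow> 'b measure) \<Rightarrow>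
     ennreal" where
  "lip g h L = (SUP (M, N) \<in> {(M, N). M \<in> Prob_wt g \<and> N \<in> Prob_wt g \<and> M \<noteq> N}.
     weighted_norm h (\<lambda>B. measure (M \<bind> L) B - measure (N \<bind> L) B) /
     weighted_norm g (\<lambda>B. measure M B - measure N B))"

end

theory Submission
  imports Defs
begin

text \<open>
  Write \<open>F\<^sub>n = U\<^sub>2\<^sub>n\<close> and \<open>G\<^sub>n = V\<^sub>2\<^sub>n\<^sub>+\<^sub>1\<close>. Besides \<open>\<pi>\<^sub>2\<^sub>n\<^sub>+\<^sub>1 = \<eta> \<K>\<^sub>2\<^sub>n\<^sub>+\<^sub>1\<close>, the Sinkhorn recursion
  gives \<open>\<mu> = \<pi>\<^sub>2\<^sub>n \<K>\<^sub>2\<^sub>n\<^sub>+\<^sub>1\<close>, and likewise on the other side, so each half step contracts the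
  weighted distance to the target by \<open>\<rho>\<close>; starting from \<open>\<pi>\<^sub>1\<close> this yields the rate \<open>\<rho>\<^sup>2\<^sup>n\<close>.
  Condition (A) and Jensen's inequality give \<open>(1 - \<delta>) U - C \<le> F\<^sub>n \<le> U + C\<close>, and similarly for \<open>G\<^sub>n\<close>;
  hence all integrals are finite and every \<open>\<pi>\<^sub>m\<close> with \<open>m \<ge> 1\<close> integrates the weights. Finally, coupling the
  common part of two densities \<open>p, q\<close> on the diagonal and the remainders independently bounds the
  transport cost by the integral of \<open>\<bar>p - q\<bar> g\<close>.
\<close>

section \<open>Total variation and couplings of densities\<close>

text \<open>The triangle inequality for integrals bounds every partition sum from above, and the
  Hahn partition into \<open>q \<le> p\<close> and \<open>p < q\<close> attains the bound. Hence the
  set function given to \<open>measure_of\<close> agrees on Borel sets with a genuine measure, and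
  \<open>measure_of\<close> returns that measure.\<close>

lemma tv_measure_density:
  fixes L :: "'a::topological_space measure" and p q :: "'a \<Rightarrow> real"
  assumes L: "sets L = sets borel" and p: "integrable L p" and q: "integrable L q"
    and p0: "\<And>x. 0 \<le> p x" and q0: "\<And>x. 0 \<le> q x"
  shows "tv_measure borel (\<lambda>B. measure (density L p) B - measure (density L q) B)
           = density L (\<lambda>x. \<bar>p x - q x\<bar>)"
proof -
  have [measurable]: "p \<in> borel_measurable L" "q \<in> borel_measurable L"
    using p q by auto
  let ?m = "\<lambda>B. measure (density L p) B - measure (density L q) B"
  let ?D = "density L (\<lambda>x. \<bar>p x - q x\<bar>)"
  let ?P = "\<lambda>A. {P. finite P \<and> disjoint P \<and> P \<subseteq> sets borel \<and> \<Union>P = A}"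
  have abs_int: "integrable L (\<lambda>x. indicator A x * \<bar>p x - q x\<bar>)" if "A \<in> sets L" for A
    using integrable_real_mult_indicator[OF that, of "\<lambda>x. \<bar>p x - q x\<bar>"] p q
    by (simp add: mult.commute)
  have m_eq: "?m B = (\<integral>x. indicator B x * (p x - q x) \<partial>L)" if B: "B \<in> sets L" for B
  proof -
    have "integrable L (\<lambda>x. indicator B x * p x)" "integrable L (\<lambda>x. indicator B x * q x)"
      using integrable_real_mult_indicator[OF B] p q by (simp_all add: mult.commute)
    moreover have "measure (density L f) B = (\<integral>x. indicator B x * f x \<partial>L)"
      if "integrable L (\<lambda>x. indicator B x * f x)" "\<And>x. 0 \<le> f x" "f \<in> borel_measurable L"
      for f :: "'a \<Rightarrow> real"
    proof -
      have "emeasure (density L f) B = (\<integral>\<^sup>+x. ennreal (indicator B x * f x) \<partial>L)"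
        using that B by (subst emeasure_density)
          (auto intro!: nn_integral_cong simp: indicator_def)
      also have "\<dots> = ennreal (\<integral>x. indicator B x * f x \<partial>L)"
        using that by (intro nn_integral_eq_integral) auto
      finally show ?thesis
        using that by (simp add: measure_def)
    qed
    ultimately show ?thesis
      using p0 q0 by (simp add: right_diff_distrib Bochner_Integration.integral_diff)
  qed
  have D_eq: "emeasure ?D B = ennreal (\<integral>x. indicator B x * \<bar>p x - q x\<bar> \<partial>L)"
    if B: "B \<in> sets L" for B
  proof -
    have "emeasure ?D B = (\<integral>\<^sup>+x. ennreal (indicator B x * \<bar>p x - q x\<bar>) \<partial>L)"
      using B by (subst emeasure_density)
        (auto intro!: nn_integral_cong simp: indicator_def)
    also have "\<dots> = ennreal (\<integral>x. indicator B x * \<bar>p x - q x\<bar> \<partial>L)"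
      using abs_int[OF B] by (intro nn_integral_eq_integral) auto
    finally show ?thesis .
  qed
  have "(SUP P\<in>?P A. \<Sum>B\<in>P. ennreal \<bar>?m B\<bar>) = emeasure ?D A" if A: "A \<in> sets borel" for A
  proof (rule antisym)
    show "(SUP P\<in>?P A. \<Sum>B\<in>P. ennreal \<bar>?m B\<bar>) \<le> emeasure ?D A"
    proof (rule SUP_least)
      fix P assume P: "P \<in> ?P A"
      have "(\<Sum>B\<in>P. ennreal \<bar>?m B\<bar>) \<le> (\<Sum>B\<in>P. emeasure ?D B)"
      proof (rule sum_mono)
        fix B assume "B \<in> P"
        then have B: "B \<in> sets L" using P L by auto
        have "\<bar>?m B\<bar> \<le> (\<integral>x. \<bar>indicator B x * (p x - q x)\<bar> \<partial>L)"
          unfolding m_eq[OF B] by (rule integral_abs_bound)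
        also have "\<dots> = (\<integral>x. indicator B x * \<bar>p x - q x\<bar> \<partial>L)"
          by (simp add: abs_mult)
        finally show "ennreal \<bar>?m B\<bar> \<le> emeasure ?D B"
          unfolding D_eq[OF B] by (rule ennreal_leI)
      qed
      also have "\<dots> = emeasure ?D (\<Union>B\<in>P. B)"
        using P L by (intro sum_emeasure) (auto simp: disjoint_family_on_def disjoint_def)
      also have "(\<Union>B\<in>P. B) = A" using P by auto
      finally show "(\<Sum>B\<in>P. ennreal \<bar>?m B\<bar>) \<le> emeasure ?D A" .
    qed
  next
    \<comment> \<open>On each piece \<open>p - q\<close> has a constant sign, so the absolute value
      passes through the integral without loss.\<close>
    define A1 where "A1 = {x\<in>space L. q x \<le> p x} \<inter> A"
    define A2 where "A2 = {x\<in>space L. p x < q x} \<inter> A"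
    have A': "A \<in> sets L" using A L by simp
    have s: "A1 \<in> sets L" "A2 \<in> sets L" 
      unfolding A1_def A2_def using A' by measurable
    have sp: "space L = UNIV" using L sets_eq_imp_space_eq by force
    have AA: "A1 \<union> A2 = A" "A1 \<inter> A2 = {}"
      unfolding A1_def A2_def sp by auto
    have e: "emeasure ?D B = ennreal \<bar>?m B\<bar>" 
      if B: "B \<in> sets L" and c: "(\<forall>x\<in>B. q x \<le> p x) \<or> (\<forall>x\<in>B. p x < q x)" for B
    proof -
      have "\<bar>?m B\<bar> = (\<integral>x. indicator B x * \<bar>p x - q x\<bar> \<partial>L)"
        using c
      proof
        assume c: "\<forall>x\<in>B. q x \<le> p x"
        have "?m B = (\<integral>x. indicator B x * \<bar>p x - q x\<bar> \<partial>L)"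
          unfolding m_eq[OF B] using c
          by (intro Bochner_Integration.integral_cong) (auto simp: indicator_def)
        then show ?thesis by (simp add: integral_nonneg_AE)
      next
        assume c: "\<forall>x\<in>B. p x < q x"
        have "?m B = (\<integral>x. - (indicator B x * \<bar>p x - q x\<bar>) \<partial>L)"
          unfolding m_eq[OF B] using c
          by (intro Bochner_Integration.integral_cong) (auto simp: indicator_def)
        then show ?thesis by (simp add: integral_nonneg_AE)
      qed
      then show ?thesis using D_eq[OF B] by simp
    qed
    have "emeasure ?D A = emeasure ?D A1 + emeasure ?D A2"
      using AA s by (subst plus_emeasure) auto
    also have "\<dots> = ennreal \<bar>?m A1\<bar> + ennreal \<bar>?m A2\<bar>"
      using s by (intro arg_cong2[where f="(+)"] e) (auto simp: A1_def A2_def)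
    \<comment> \<open>The disjoint pieces coincide only when both are empty; the set then has a
      single element, but the lost summand is 0.\<close>
    also have "\<dots> = (\<Sum>B\<in>{A1, A2}. ennreal \<bar>?m B\<bar>)"
      using AA by (cases "A1 = A2") auto
    also have "\<dots> \<le> (SUP P\<in>?P A. \<Sum>B\<in>P. ennreal \<bar>?m B\<bar>)"
      using AA s L by (intro SUP_upper) (auto simp: disjoint_def)
    finally show "emeasure ?D A \<le> (SUP P\<in>?P A. \<Sum>B\<in>P. ennreal \<bar>?m B\<bar>)" .
  qed
  then have eq: "(SUP P\<in>?P A. \<Sum>B\<in>P. ennreal \<bar>?m B\<bar>) = emeasure ?D A" if "A \<in> sets borel" for A
    using that by blast
  have sp: "space (borel :: 'a measure) = space ?D" and st: "sets (borel :: 'a measure) = sets ?D"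
    using L sets_eq_imp_space_eq[OF L] by auto
  have "tv_measure borel ?m = measure_of (space ?D) (sets ?D) (emeasure ?D)"
    unfolding tv_measure_def sp[symmetric] st[symmetric]
  proof (rule measure_of_eq)
    fix A assume "A \<in> sigma_sets (space borel) (sets (borel :: 'a measure))"
    then have "A \<in> sets borel" by (metis sets.sigma_sets_eq)
    then show "(SUP P\<in>?P A. \<Sum>B\<in>P. ennreal \<bar>?m B\<bar>) = emeasure ?D A" by (rule eq)
  qed simp
  also have "\<dots> = ?D" by (rule measure_of_of_measure)
  finally show ?thesis .
qed

lemma weighted_norm_density:
  fixes L :: "'a::topological_space measure" and p q :: "'a \<Rightarrow> real"
  assumes L: "sets L = sets borel" and p: "integrable L p" and q: "integrable L q"
    and p0: "\<And>x. 0 \<le> p x" and q0: "\<And>x. 0 \<le> q x"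
    and g: "g \<in> borel_measurable borel"
  shows "weighted_norm g (\<lambda>B. measure (density L p) B - measure (density L q) B)
           = (\<integral>\<^sup>+x. ennreal \<bar>p x - q x\<bar> * ennreal (g x) \<partial>L)"
proof -
  have [measurable]: "p \<in> borel_measurable L" "q \<in> borel_measurable L"
    using p q by auto
  have [measurable]: "g \<in> borel_measurable L"
    using g measurable_cong_sets[OF L refl] by auto
  show ?thesis
    unfolding weighted_norm_def tv_measure_density[OF assms(1-5)]
    by (subst nn_integral_density) auto
qed

text \<open>Unfolds the supremum of ratios into the inequality it stands for. Weighted integrability
  of \<open>p\<close> and \<open>q\<close> makes the denominator finite, so it can be cancelled in
  \<open>ennreal\<close>; the degenerate pairs are treated separately.\<close>

lemma lip_step:
  fixes lam :: "'a::topological_space measure" and nu :: "'b::topological_space measure"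
    and p q :: "'a \<Rightarrow> real" and p' q' :: "'b \<Rightarrow> real"
  assumes lam: "sets lam = sets borel" and nu: "sets nu = sets borel"
    and prob: "prob_space (density lam p)" "prob_space (density lam q)"
    and int: "integrable lam p" "integrable lam q" "integrable nu p'" "integrable nu q'"
    and nonneg: "\<And>x. 0 \<le> p x" "\<And>x. 0 \<le> q x" "\<And>y. 0 \<le> p' y" "\<And>y. 0 \<le> q' y"
    and g: "g \<in> borel_measurable borel" and h: "h \<in> borel_measurable borel"
    and p': "density lam p \<bind> L = density nu p'" and q': "density lam q \<bind> L = density nu q'"
    and lip: "lip g h L \<le> ennreal \<rho>"
    and fin: "(\<integral>\<^sup>+x. ennreal (p x) * ennreal (g x) \<partial>lam) < \<infinity>"
      "(\<integral>\<^sup>+x. ennreal (q x) * ennreal (g x) \<partial>lam) < \<infinity>"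
  shows "(\<integral>\<^sup>+y. ennreal \<bar>p' y - q' y\<bar> * ennreal (h y) \<partial>nu)
           \<le> ennreal \<rho> * (\<integral>\<^sup>+x. ennreal \<bar>p x - q x\<bar> * ennreal (g x) \<partial>lam)"
proof -
  let ?M = "density lam p" and ?N = "density lam q"
  have [measurable]: "p \<in> borel_measurable lam" "q \<in> borel_measurable lam"
    using int by auto
  have [measurable]: "g \<in> borel_measurable lam"
    using g measurable_cong_sets[OF lam refl] by auto
  have "(\<integral>\<^sup>+x. ennreal \<bar>p x - q x\<bar> * ennreal (g x) \<partial>lam)
      \<le> (\<integral>\<^sup>+x. ennreal (p x) * ennreal (g x) + ennreal (q x) * ennreal (g x) \<partial>lam)"
    by (intro nn_integral_mono, subst distrib_right[symmetric], rule mult_right_mono)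
      (use nonneg in \<open>auto simp: abs_le_iff ennreal_plus[symmetric] add_increasing add_increasing2
        simp del: ennreal_plus intro!: ennreal_leI\<close>)
  also have "\<dots> = (\<integral>\<^sup>+x. ennreal (p x) * ennreal (g x) \<partial>lam)
      + (\<integral>\<^sup>+x. ennreal (q x) * ennreal (g x) \<partial>lam)"
    by (rule nn_integral_add) auto
  also have "\<dots> < \<infinity>" using fin by simp
  finally have finite: "(\<integral>\<^sup>+x. ennreal \<bar>p x - q x\<bar> * ennreal (g x) \<partial>lam) < \<infinity>" .
  have M: "?M \<in> Prob_wt g"
    unfolding Prob_wt_def using prob lam fin by (simp add: nn_integral_density)
  have N: "?N \<in> Prob_wt g"
    unfolding Prob_wt_def using prob lam fin by (simp add: nn_integral_density)
  let ?x = "weighted_norm h (\<lambda>B. measure (?M \<bind> L) B - measure (?N \<bind> L) B)"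
  let ?y = "weighted_norm g (\<lambda>B. measure ?M B - measure ?N B)"
  have x: "?x = (\<integral>\<^sup>+y. ennreal \<bar>p' y - q' y\<bar> * ennreal (h y) \<partial>nu)"
    unfolding p' q' using nu int nonneg h by (intro weighted_norm_density) auto
  have y: "?y = (\<integral>\<^sup>+x. ennreal \<bar>p x - q x\<bar> * ennreal (g x) \<partial>lam)"
    using lam int nonneg g by (intro weighted_norm_density) auto
  have "?x \<le> ennreal \<rho> * ?y"
  proof (cases "?M = ?N")
    \<comment> \<open>Equal measures are excluded from the supremum, but then their images agree and
      the left-hand side is 0.\<close>
    case True
    have "weighted_norm h (\<lambda>B. measure (density nu p') B - measure (density nu p') B) = 0"
      using nu int nonneg h by (subst weighted_norm_density) auto
    then show ?thesis using True p' by simp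
  next
    case False
    have "?x / ?y \<le> lip g h L"
      unfolding lip_def using M N False by (intro SUP_upper2[of "(?M, ?N)"]) auto
    also note lip
    finally have le: "?x / ?y \<le> ennreal \<rho>" .
    show ?thesis
    proof (cases "?y = 0")
      \<comment> \<open>In \<open>ennreal\<close> a nonzero numerator over 0 is \<open>top\<close>,
        so the finite bound on the ratio forces the numerator to vanish as well.\<close>
      case True
      then show ?thesis using le
        by (cases "?x = 0") (auto simp: top_unique divide_ennreal_def ennreal_mult_eq_top_iff)
    next
      case False
      have "?x = ?x / ?y * ?y"
        using False finite y by (simp add: ennreal_divide_times ennreal_divide_self less_top)
      also have "\<dots> \<le> ennreal \<rho> * ?y" using le by (rule mult_right_mono) simp
      finally show ?thesis .
    qed
  qed
  then show ?thesis unfolding x y .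
qed

section \<open>A coupling of two densities\<close>

text \<open>The mass \<open>w\<close> placed on the diagonal costs nothing. The excesses
  \<open>u\<close> and \<open>v\<close> have a common mass \<open>c\<close>, and their product
  divided by \<open>c\<close> costs at most the integral of \<open>(u + v) g\<close>, because the
  cost is bounded by a sum of one function of each variable. No triangle inequality for \<psi>
  enters.\<close>

lemma transport_cost_density_le:
  fixes L :: "'a::polish_space measure" and p q g :: "'a \<Rightarrow> real"
  assumes L: "sets L = sets borel" and p: "p \<in> borel_measurable borel" and q: "q \<in> borel_measurable borel"
    and p0: "\<And>x. 0 \<le> p x" and q0: "\<And>x. 0 \<le> q x"
    and prob: "prob_space (density L p)" "prob_space (density L q)"
    and psi: "(\<lambda>z. \<psi> (fst z) (snd z)) \<in> borel_measurable borel" and diag: "\<And>x. \<psi> x x = 0"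
    and le: "\<And>x y. \<psi> x y \<le> g x + g y"
    and g: "g \<in> borel_measurable borel" and g0: "\<And>x. 0 \<le> g x"
  shows "transport_cost \<psi> (density L p) (density L q)
           \<le> (\<integral>\<^sup>+x. ennreal \<bar>p x - q x\<bar> * ennreal (g x) \<partial>L)"
proof -
  note [measurable_cong] = L
  note [measurable] = p q g
  have sL: "space L = UNIV" using sets_eq_imp_space_eq[OF L] by simp
  define w where "w x = ennreal (min (p x) (q x))" for x
  define u where "u x = ennreal (p x - min (p x) (q x))" for x
  define v where "v x = ennreal (q x - min (p x) (q x))" for x
  have [measurable]: "w \<in> borel_measurable borel" "u \<in> borel_measurable borel" "v \<in> borel_measurable borel"
    unfolding w_def u_def v_def by auto
  have wu: "ennreal (p x) = w x + u x" and wv: "ennreal (q x) = w x + v x"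
    and uv: "ennreal \<bar>p x - q x\<bar> = u x + v x" for x
    unfolding w_def u_def v_def using p0[of x] q0[of x]
    by (auto simp: ennreal_plus[symmetric] min_def simp del: ennreal_plus)
  have one: "(\<integral>\<^sup>+x. ennreal (p x) \<partial>L) = 1" "(\<integral>\<^sup>+x. ennreal (q x) \<partial>L) = 1"
    using prob[THEN prob_space.emeasure_space_1] by (simp_all add: emeasure_density sL)
  then have one': "(\<integral>\<^sup>+x. w x \<partial>L) + (\<integral>\<^sup>+x. u x \<partial>L) = 1" "(\<integral>\<^sup>+x. w x \<partial>L) + (\<integral>\<^sup>+x. v x \<partial>L) = 1"
    unfolding wu wv by (auto simp: nn_integral_add)
  define c where "c = (\<integral>\<^sup>+x. u x \<partial>L)"
  have w1: "(\<integral>\<^sup>+x. w x \<partial>L) \<le> 1" and c1: "c \<le> 1"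
    using one' unfolding c_def by (metis le_add_same_cancel1 zero_le le_iff_add add.commute)+
  \<comment> \<open>Both densities have mass 1, so removing the common part leaves equal masses;
    cancelling in \<open>ennreal\<close> requires the removed mass to be finite.\<close>
  have cv: "(\<integral>\<^sup>+x. v x \<partial>L) = c"
    using one' w1 ennreal_add_left_cancel[of "\<integral>\<^sup>+x. w x \<partial>L" "\<integral>\<^sup>+x. v x \<partial>L" "\<integral>\<^sup>+x. u x \<partial>L"]
    unfolding c_def by (auto simp: top_unique)
  have ctop: "c \<noteq> top" using c1 by (auto simp: top_unique)
  \<comment> \<open>The normalising factor \<open>1/c\<close>, set to 0 when there is no excess
    mass, since the inverse of 0 in \<open>ennreal\<close> is \<open>top\<close>.\<close>
  define k where "k = (if c = 0 then 0 else inverse c)"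
  have ck: "c * k \<le> 1"
    unfolding k_def using ctop by (auto simp: divide_ennreal_def[symmetric] less_top)
  have absorb: "c * k * (\<integral>\<^sup>+x. t x * f x \<partial>L) = (\<integral>\<^sup>+x. t x * f x \<partial>L)"
    if t: "(\<integral>\<^sup>+x. t x \<partial>L) = c" and [measurable]: "t \<in> borel_measurable borel" for t f :: "'a \<Rightarrow> ennreal"
  proof (cases "c = 0")
    case True
    then have "AE x in L. t x = 0" using t nn_integral_0_iff_AE[of t L] by auto
    then have "(\<integral>\<^sup>+x. t x * f x \<partial>L) = (\<integral>\<^sup>+x. 0 \<partial>L)"
      by (intro nn_integral_cong_AE) auto
    then show ?thesis by simp
  next
    case False
    then have "c * k = 1" unfolding k_def using ctop
      by (auto simp: divide_ennreal_def[symmetric] less_top)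
    then show ?thesis by simp
  qed
  let ?B = "borel \<Otimes>\<^sub>M borel :: ('a \<times> 'a) measure"
  define Q1 where "Q1 = distr (density L w) ?B (\<lambda>x. (x, x))"
  define Q2 where "Q2 = density L u \<Otimes>\<^sub>M density L (\<lambda>y. k * v y)"
  have emv: "emeasure (density L (\<lambda>y. k * v y)) UNIV = c * k"
    using sL cv by (simp add: emeasure_density nn_integral_cmult mult.commute)
  \<comment> \<open>Fubini needs a sigma-finite second factor. Nothing of the kind is assumed of
    \<open>L\<close>, but the normalised excess is a finite measure.\<close>
  interpret V: finite_measure "density L (\<lambda>y. k * v y)"
    using emv ck sL by (intro finite_measureI) (auto simp: top_unique)
  have Q2int: "(\<integral>\<^sup>+z. f z \<partial>Q2) = (\<integral>\<^sup>+x. u x * (\<integral>\<^sup>+y. k * v y * f (x, y) \<partial>L) \<partial>L)"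
    if [measurable]: "f \<in> borel_measurable ?B" for f
  proof -
    have "(\<integral>\<^sup>+z. f z \<partial>Q2) = (\<integral>\<^sup>+x. \<integral>\<^sup>+y. f (x, y) \<partial>density L (\<lambda>y. k * v y) \<partial>density L u)"
      unfolding Q2_def by (rule V.nn_integral_fst[symmetric]) measurable
    also have "\<dots> = (\<integral>\<^sup>+x. u x * (\<integral>\<^sup>+y. f (x, y) \<partial>density L (\<lambda>y. k * v y)) \<partial>L)"
      by (rule nn_integral_density) auto
    also have "\<dots> = (\<integral>\<^sup>+x. u x * (\<integral>\<^sup>+y. k * v y * f (x, y) \<partial>L) \<partial>L)"
      by (intro nn_integral_cong arg_cong2[where f="(*)"] refl nn_integral_density) auto
    finally show ?thesis .
  qed
  have "(\<integral>\<^sup>+z. 1 \<partial>Q1) = (\<integral>\<^sup>+x. w x \<partial>L)"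
    unfolding Q1_def
    by (subst nn_integral_distr) (auto simp: nn_integral_density simp del: nn_integral_const)
  \<comment> \<open>Both pieces must be sub-probabilities, because they are summed through the Giry
    bind.\<close>
  with w1 have s1: "subprob_space Q1"
    by (intro subprob_spaceI) (simp_all, simp add: Q1_def space_pair_measure)
  have "(\<integral>\<^sup>+z. 1 \<partial>Q2) = (\<integral>\<^sup>+x. u x * (\<integral>\<^sup>+y. k * v y \<partial>L) \<partial>L)"
    using Q2int[of "\<lambda>_. 1"] by (simp del: nn_integral_const)
  also have "\<dots> = c * (c * k)"
    by (simp add: nn_integral_cmult nn_integral_multc cv c_def[symmetric] mult.commute)
  also have "\<dots> \<le> 1 * 1" by (rule mult_mono) (use c1 ck in auto)
  finally have s2: "subprob_space Q2"
    by (intro subprob_spaceI) (simp_all, simp add: Q2_def space_pair_measure sL)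
  have sets1: "sets Q1 = sets ?B" and sets2: "sets Q2 = sets ?B"
    unfolding Q1_def Q2_def using L by (auto intro!: sets_pair_measure_cong)
  \<comment> \<open>binding over the counting measure on \<open>bool\<close> is the sum \<open>Q1 + Q2\<close>\<close>
  define Q where "Q = count_space UNIV \<bind> (\<lambda>b. if b then Q1 else Q2)"
  have in_space: "Q1 \<in> space (subprob_algebra ?B)" "Q2 \<in> space (subprob_algebra ?B)"
    unfolding space_subprob_algebra using s1 s2 sets1 sets2 by simp_all
  have [measurable]: "(\<lambda>b. if b then Q1 else Q2) \<in> measurable (count_space UNIV) (subprob_algebra ?B)"
    unfolding measurable_count_space_eq1 by (auto intro: in_space)
  have setsQ: "sets Q = sets ?B"
    unfolding Q_def by (rule sets_bind) (use sets1 sets2 in auto)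
  have Qint: "(\<integral>\<^sup>+z. f z \<partial>Q) = (\<integral>\<^sup>+x. w x * f (x, x) \<partial>L)
      + (\<integral>\<^sup>+x. u x * (\<integral>\<^sup>+y. k * v y * f (x, y) \<partial>L) \<partial>L)"
    if f [measurable]: "f \<in> borel_measurable ?B" for f
  proof -
    have "(\<integral>\<^sup>+z. f z \<partial>Q) = (\<integral>\<^sup>+z. f z \<partial>Q1) + (\<integral>\<^sup>+z. f z \<partial>Q2)"
      unfolding Q_def by (subst nn_integral_bind[OF f])
        (auto intro: in_space simp: nn_integral_count_space_finite UNIV_bool add.commute)
    also have "(\<integral>\<^sup>+z. f z \<partial>Q1) = (\<integral>\<^sup>+x. w x * f (x, x) \<partial>L)"
      unfolding Q1_def by (subst nn_integral_distr) (auto simp: nn_integral_density)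
    finally show ?thesis by (simp add: Q2int)
  qed
  have "Q \<in> couplings (density L p) (density L q)"
    unfolding couplings_def
  proof (intro CollectI conjI)
    show "sets Q = sets (density L p \<Otimes>\<^sub>M density L q)"
      unfolding setsQ using L by (auto intro!: sets_pair_measure_cong)
    note [measurable_cong] = setsQ
    show "distr Q (density L p) fst = density L p"
    proof (rule measure_eqI)
      fix E assume "E \<in> sets (distr Q (density L p) fst)"
      then have [measurable]: "E \<in> sets borel" using L by simp
      have "emeasure (distr Q (density L p) fst) E = (\<integral>\<^sup>+x. indicator E x \<partial>distr Q (density L p) fst)"
        by simp
      also have "\<dots> = (\<integral>\<^sup>+z. indicator E (fst z) \<partial>Q)"
        by (rule nn_integral_distr) measurable
      also have "\<dots> = (\<integral>\<^sup>+x. w x * indicator E x \<partial>L) + (\<integral>\<^sup>+x. c * k * (u x * indicator E x) \<partial>L)"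
        by (subst Qint) (auto simp: nn_integral_multc nn_integral_cmult cv mult_ac)
      also have "\<dots> = (\<integral>\<^sup>+x. w x * indicator E x \<partial>L) + (\<integral>\<^sup>+x. u x * indicator E x \<partial>L)"
        by (subst nn_integral_cmult) (auto simp: absorb c_def[symmetric])
      also have "\<dots> = (\<integral>\<^sup>+x. ennreal (p x) * indicator E x \<partial>L)"
        by (subst nn_integral_add[symmetric]) (auto simp: wu distrib_right)
      finally show "emeasure (distr Q (density L p) fst) E = emeasure (density L p) E"
        by (simp add: emeasure_density)
    qed simp
    show "distr Q (density L q) snd = density L q"
    proof (rule measure_eqI)
      fix E assume "E \<in> sets (distr Q (density L q) snd)"
      then have [measurable]: "E \<in> sets borel" using L by simp
      have "emeasure (distr Q (density L q) snd) E = (\<integral>\<^sup>+x. indicator E x \<partial>distr Q (density L q) snd)"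
        by simp
      also have "\<dots> = (\<integral>\<^sup>+z. indicator E (snd z) \<partial>Q)"
        by (rule nn_integral_distr) measurable
      also have "\<dots> = (\<integral>\<^sup>+x. w x * indicator E x \<partial>L) + c * (\<integral>\<^sup>+y. k * (v y * indicator E y) \<partial>L)"
        by (subst Qint) (auto simp: nn_integral_multc c_def mult.assoc)
      also have "\<dots> = (\<integral>\<^sup>+x. w x * indicator E x \<partial>L) + (\<integral>\<^sup>+x. v x * indicator E x \<partial>L)"
        by (subst nn_integral_cmult) (auto simp: absorb cv mult.assoc[symmetric])
      also have "\<dots> = (\<integral>\<^sup>+x. ennreal (q x) * indicator E x \<partial>L)"
        by (subst nn_integral_add[symmetric]) (auto simp: wv distrib_right)
      finally show "emeasure (distr Q (density L q) snd) E = emeasure (density L q) E"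
        by (simp add: emeasure_density)
    qed simp
  qed
  then have "transport_cost \<psi> (density L p) (density L q) \<le> (\<integral>\<^sup>+z. ennreal (\<psi> (fst z) (snd z)) \<partial>Q)"
    unfolding transport_cost_def by (rule INF_lower)
  also have "\<dots> = (\<integral>\<^sup>+x. u x * (\<integral>\<^sup>+y. k * v y * ennreal (\<psi> x y) \<partial>L) \<partial>L)"
    using psi by (subst Qint) (auto simp: diag borel_prod)
  also have "\<dots> \<le> (\<integral>\<^sup>+x. u x * (\<integral>\<^sup>+y. k * v y * (ennreal (g x) + ennreal (g y)) \<partial>L) \<partial>L)"
    by (intro nn_integral_mono mult_left_mono)
      (auto simp: g0 le ennreal_plus[symmetric] simp del: ennreal_plus intro!: ennreal_leI)
  also have "\<dots> = (\<integral>\<^sup>+x. c * k * (u x * ennreal (g x)) + u x * (\<integral>\<^sup>+y. k * (v y * ennreal (g y)) \<partial>L) \<partial>L)"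
    by (simp add: distrib_left nn_integral_add nn_integral_multc nn_integral_cmult cv mult_ac)
  also have "\<dots> = c * k * (\<integral>\<^sup>+x. u x * ennreal (g x) \<partial>L) + c * (\<integral>\<^sup>+y. k * (v y * ennreal (g y)) \<partial>L)"
    by (subst nn_integral_add) (auto simp: nn_integral_cmult nn_integral_multc c_def)
  also have "\<dots> = c * k * (\<integral>\<^sup>+x. u x * ennreal (g x) \<partial>L) + c * k * (\<integral>\<^sup>+x. v x * ennreal (g x) \<partial>L)"
    by (simp add: nn_integral_cmult mult.assoc)
  also have "\<dots> = (\<integral>\<^sup>+x. u x * ennreal (g x) \<partial>L) + (\<integral>\<^sup>+x. v x * ennreal (g x) \<partial>L)"
    by (simp add: absorb cv c_def[symmetric])
  also have "\<dots> = (\<integral>\<^sup>+x. ennreal \<bar>p x - q x\<bar> * ennreal (g x) \<partial>L)"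
    by (subst nn_integral_add[symmetric]) (auto simp: uv distrib_right)
  finally show ?thesis .
qed

section \<open>Half steps of the Sinkhorn iteration\<close>

text \<open>The odd transition with its potential as a free parameter. With the two spaces exchanged
  it is the even transition.\<close>

definition sinkhorn_kernel ::
  "'a measure \<Rightarrow> ('a \<Rightarrow> 'b \<Rightarrow> real) \<Rightarrow> ('a \<Rightarrow> real) \<Rightarrow> 'b \<Rightarrow> 'a measure" where
  "sinkhorn_kernel lam W F y =
     density lam (\<lambda>x. ennreal (exp (- W x y - F x) / K_flat lam W (\<lambda>x'. exp (- F x')) y))"

text \<open>The invariant of the recursion. The lower bound makes \<open>exp (- F)\<close> times the
  weight \<open>exp (\<delta> * U)\<close> comparable to
  \<open>exp (- (1 - 2 * \<delta>) * U)\<close>, which condition (A) integrates; the upper bound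
  compares \<open>exp (- F)\<close> from below with \<open>exp (- U)\<close>, so that Jensen's
  inequality can be used under \<mu>.\<close>

definition tame :: "real \<Rightarrow> ('a::topological_space \<Rightarrow> real) \<Rightarrow> ('a \<Rightarrow> real) \<Rightarrow> bool" where
  "tame \<delta> U F \<longleftrightarrow> F \<in> borel_measurable borel \<and>
     (\<exists>C. \<forall>x. (1 - \<delta>) * U x - C \<le> F x \<and> F x \<le> U x + C)"

lemma K_op_eq_K_flat: "K_op nu W f = K_flat nu (\<lambda>y x. W x y) f"
  by (simp add: K_op_def K_flat_def fun_eq_iff)

text \<open>
  The assumptions are symmetric under exchanging the two spaces (lemma \<open>swap\<close>), so a statement about
  one half step covers both parities.
\<close>

locale gibbs_pair =
  fixes lam :: "'a::polish_space measure" and nu :: "'b::polish_space measure"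
    and U :: "'a \<Rightarrow> real" and V :: "'b \<Rightarrow> real" and W :: "'a \<Rightarrow> 'b \<Rightarrow> real"
    and \<delta> b w t :: real
  assumes sets_lam: "sets lam = sets borel" and sets_nu: "sets nu = sets borel"
    and U_borel: "U \<in> borel_measurable borel" and V_borel: "V \<in> borel_measurable borel"
    and W_borel: "(\<lambda>z. W (fst z) (snd z)) \<in> borel_measurable borel"
    and \<delta>: "0 < \<delta>" "\<delta> < 1/2"
    and U_ge: "b \<le> U x" and V_ge: "b \<le> V y"
    and exp_W_le: "exp (- W x y) \<le> w"
    and prob_U: "prob_space (gibbs lam U)" and prob_V: "prob_space (gibbs nu V)"
    and fin_U: "emeasure (gibbs lam (\<lambda>x. (1 - 2 * \<delta>) * U x)) UNIV < \<infinity>"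
    and fin_V: "emeasure (gibbs nu (\<lambda>y. (1 - 2 * \<delta>) * V y)) UNIV < \<infinity>"
    and int_W_U: "integrable (gibbs lam U) (\<lambda>x. W x y)"
    and int_W_V: "integrable (gibbs nu V) (\<lambda>y. W x y)"
    and mean_U: "(\<integral>x. W x y \<partial>gibbs lam U) \<le> \<delta> * V y + t"
    and mean_V: "(\<integral>y. W x y \<partial>gibbs nu V) \<le> \<delta> * U x + t"
begin

lemma swap: "gibbs_pair nu lam V U (\<lambda>y x. W x y) \<delta> b w t"
proof (rule gibbs_pair.intro)
  have "(\<lambda>z. (snd z, fst z)) \<in> measurable (borel :: ('b \<times> 'a) measure) borel"
    unfolding borel_prod[symmetric] by measurable
  from measurable_compose[OF this W_borel]
  show "(\<lambda>z. W (snd z) (fst z)) \<in> borel_measurable borel" by simp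
qed (fact sets_lam sets_nu U_borel V_borel \<delta> U_ge V_ge exp_W_le prob_U prob_V fin_U fin_V
      int_W_U int_W_V mean_U mean_V)+

declare sets_lam[measurable_cong] sets_nu[measurable_cong]
declare U_borel[measurable] V_borel[measurable]

lemma W_measurable[measurable (raw)]:
  assumes "f \<in> measurable M borel" "g \<in> measurable M borel"
  shows "(\<lambda>z. W (f z) (g z)) \<in> borel_measurable M"
  using measurable_compose[OF measurable_Pair[OF assms], unfolded borel_prod, OF W_borel] by simp

lemma space_lam: "space lam = UNIV"
  using sets_eq_imp_space_eq[OF sets_lam] by simp

text \<open>\<open>lam\<close> has the finite density \<open>exp U\<close> with respect to the
  probability measure \<open>gibbs lam U\<close>. This is what makes Tonelli and the measurability
  of \<open>K_flat\<close> available.\<close>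

lemma sigma_finite_lam: "sigma_finite_measure lam"
proof -
  interpret mu: prob_space "gibbs lam U" by (rule prob_U)
  have eq: "density (gibbs lam U) (\<lambda>x. ennreal (exp (U x))) = lam"
    unfolding gibbs_def
    by (subst density_density_eq)
      (auto simp: ennreal_mult'[symmetric] exp_add[symmetric] density_1)
  have "sigma_finite_measure (density (gibbs lam U) (\<lambda>x. ennreal (exp (U x))))"
    by (subst mu.sigma_finite_iff_density_finite) (auto simp: gibbs_def)
  then show ?thesis unfolding eq .
qed

section \<open>Integrability and bounds for the potentials\<close>

text \<open>As \<open>U\<close> is bounded below, the whole weight is at most a constant times
  \<open>exp (\<delta> * U)\<close>, and the product with \<open>p\<close> is dominated by the
  integrable \<open>exp (- (1 - 2 * \<delta>) * U)\<close>. Plain integrability follows because the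
  weight is at least 1/2.\<close>

lemma weight_finite:
  assumes p: "p \<in> borel_measurable borel" and le: "\<And>x. p x \<le> C * exp (- (1 - \<delta>) * U x)"
    and p0: "\<And>x. 0 \<le> p x" and a: "0 \<le> a"
  shows "(\<integral>\<^sup>+x. ennreal (p x) * ennreal (1/2 + a * exp (\<delta> * U x)) \<partial>lam) < \<infinity>"
    and "integrable lam p"
proof -
  note [measurable] = p
  define C' where "C' = C * (exp (- \<delta> * b) / 2 + a)"
  \<comment> \<open>Lets the constant 1/2 in the weight be absorbed into a multiple of
    \<open>exp (\<delta> * U)\<close>.\<close>
  have ge1: "1 \<le> exp (- \<delta> * b) * exp (\<delta> * U x)" for x
    using U_ge[of x] \<delta> by (simp add: exp_add[symmetric] algebra_simps)
  \<comment> \<open>The sign of \<open>C\<close> is not assumed; evaluating the domination of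
    \<open>p\<close> at any one point gives it.\<close>
  have C0: "0 \<le> C"
  proof -
    have "0 \<le> C * exp (- (1 - \<delta>) * U undefined)" using le p0 order_trans by blast
    then show ?thesis by (simp add: zero_le_mult_iff)
  qed
  have *: "(\<integral>\<^sup>+x. ennreal (p x) * ennreal (1/2 + a * exp (\<delta> * U x)) \<partial>lam)
      \<le> (\<integral>\<^sup>+x. ennreal C' * ennreal (exp (- ((1 - 2 * \<delta>) * U x))) \<partial>lam)"
  proof (rule nn_integral_mono)
    fix x
    have "p x * (1/2 + a * exp (\<delta> * U x))
        \<le> (C * exp (- (1 - \<delta>) * U x)) * ((exp (- \<delta> * b) / 2 + a) * exp (\<delta> * U x))"
      using ge1[of x] a p0 le C0 by (intro mult_mono) (auto simp: distrib_right)
    also have "\<dots> = C' * (exp (- (1 - \<delta>) * U x) * exp (\<delta> * U x))"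
      by (simp add: C'_def)
    also have "exp (- (1 - \<delta>) * U x) * exp (\<delta> * U x) = exp (- ((1 - 2 * \<delta>) * U x))"
      by (simp add: exp_add[symmetric] algebra_simps)
    finally show "ennreal (p x) * ennreal (1/2 + a * exp (\<delta> * U x))
        \<le> ennreal C' * ennreal (exp (- ((1 - 2 * \<delta>) * U x)))"
      using p0 a C0 by (simp add: ennreal_mult[symmetric] C'_def del: ennreal_plus)
  qed
  also have "\<dots> = ennreal C' * emeasure (gibbs lam (\<lambda>x. (1 - 2 * \<delta>) * U x)) UNIV"
    using space_lam by (simp add: gibbs_def emeasure_density nn_integral_cmult)
  also have "\<dots> < \<infinity>" using fin_U by (simp add: ennreal_mult_less_top)
  finally show fin: "(\<integral>\<^sup>+x. ennreal (p x) * ennreal (1/2 + a * exp (\<delta> * U x)) \<partial>lam) < \<infinity>" .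
  have "(\<integral>\<^sup>+x. ennreal (p x) \<partial>lam)
      \<le> (\<integral>\<^sup>+x. 2 * (ennreal (p x) * ennreal (1/2 + a * exp (\<delta> * U x))) \<partial>lam)"
  proof (rule nn_integral_mono)
    fix x
    have "p x * 1 \<le> p x * (2 * (1/2 + a * exp (\<delta> * U x)))"
      using p0 a by (intro mult_left_mono) auto
    then have "p x \<le> 2 * (p x * (1/2 + a * exp (\<delta> * U x)))" by (simp add: distrib_left mult_ac)
    then have "ennreal (p x) \<le> ennreal (2 * (p x * (1/2 + a * exp (\<delta> * U x))))"
      by (rule ennreal_leI)
    also have "\<dots> = 2 * (ennreal (p x) * ennreal (1/2 + a * exp (\<delta> * U x)))"
      using p0[of x] a by (simp add: ennreal_mult del: ennreal_plus)
    finally show "ennreal (p x) \<le> 2 * (ennreal (p x) * ennreal (1/2 + a * exp (\<delta> * U x)))" .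
  qed
  also have "\<dots> = 2 * (\<integral>\<^sup>+x. ennreal (p x) * ennreal (1/2 + a * exp (\<delta> * U x)) \<partial>lam)"
    by (rule nn_integral_cmult) auto
  also have "\<dots> < \<infinity>" using fin by (simp add: ennreal_mult_less_top)
  finally show "integrable lam p" using p0 by (intro integrableI_nonneg) auto
qed

lemma tame_integrable:
  assumes "tame \<delta> U F"
  shows "integrable lam (\<lambda>x. exp (- W x y) * exp (- F x))"
proof -
  from assms obtain C where [measurable]: "F \<in> borel_measurable borel"
    and C: "\<And>x. (1 - \<delta>) * U x - C \<le> F x" unfolding tame_def by blast
  have "exp (- W x y) * exp (- F x) \<le> (w * exp C) * exp (- (1 - \<delta>) * U x)" for x
  proof -
    have "exp (- F x) \<le> exp C * exp (- (1 - \<delta>) * U x)"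
      using C[of x] by (simp add: exp_add[symmetric] algebra_simps)
    then show ?thesis
      unfolding mult.assoc using exp_W_le[of x y] by (intro mult_mono) (auto intro: order_trans[OF _ exp_W_le])
  qed
  then show ?thesis by (intro weight_finite(2)[where a=0]) auto
qed

lemma K_flat_measurable:
  assumes [measurable]: "f \<in> borel_measurable borel"
  shows "K_flat lam W f \<in> borel_measurable borel"
proof -
  interpret sigma_finite_measure lam by (rule sigma_finite_lam)
  show ?thesis unfolding K_flat_def by measurable
qed

text \<open>From above, \<open>exp (- W)\<close> is at most \<open>w\<close> and the rest has a
  finite integral. From below, replacing \<open>F\<close> by \<open>U + C\<close> leaves the
  \<mu>-mean of \<open>exp (- W)\<close>, which Jensen bounds by the exponential of minus the mean
  of \<open>W\<close>; that mean is at most \<open>\<delta> * V y + t\<close>.\<close>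

lemma K_flat_bounds:
  assumes "tame \<delta> U F"
  obtains C where "C > 0" "\<And>y. K_flat lam W (\<lambda>x. exp (- F x)) y \<le> C"
    "\<And>y. exp (- \<delta> * V y) / C \<le> K_flat lam W (\<lambda>x. exp (- F x)) y"
proof -
  from assms obtain C where [measurable]: "F \<in> borel_measurable borel"
    and C: "\<And>x. (1 - \<delta>) * U x - C \<le> F x" "\<And>x. F x \<le> U x + C" unfolding tame_def by blast
  interpret mu: prob_space "gibbs lam U" by (rule prob_U)
  have intI: "integrable lam (\<lambda>x. exp (- (1 - \<delta>) * U x))"
    by (intro weight_finite(2)[where a=0 and C=1]) auto
  define C1 where "C1 = (\<integral>x. (w * exp C) * exp (- (1 - \<delta>) * U x) \<partial>lam)"
  have up: "K_flat lam W (\<lambda>x. exp (- F x)) y \<le> C1" for y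
    unfolding K_flat_def C1_def
  proof (intro integral_mono tame_integrable[OF assms])
    show "integrable lam (\<lambda>x. (w * exp C) * exp (- (1 - \<delta>) * U x))" using intI by simp
    fix x
    have "exp (- F x) \<le> exp C * exp (- (1 - \<delta>) * U x)"
      using C[of x] by (simp add: exp_add[symmetric] algebra_simps)
    then show "exp (- W x y) * exp (- F x) \<le> (w * exp C) * exp (- (1 - \<delta>) * U x)"
      unfolding mult.assoc using exp_W_le[of x y] by (intro mult_mono) (auto intro: order_trans[OF _ exp_W_le])
  qed
  have low: "exp (- \<delta> * V y) * exp (- t - C) \<le> K_flat lam W (\<lambda>x. exp (- F x)) y" for y
  proof -
    define m where "m = (\<integral>x. W x y \<partial>gibbs lam U)"
    have int_e: "integrable (gibbs lam U) (\<lambda>x. exp (- W x y))"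
      using exp_W_le by (intro mu.integrable_const_bound[where B=w]) (auto simp: gibbs_def)
    \<comment> \<open>Jensen's inequality, from the tangent line of \<open>exp\<close> at \<open>- m\<close>\<close>
    have "exp (- m) = (\<integral>x. exp (- m) * (1 + m - W x y) \<partial>gibbs lam U)"
      using int_W_U[of y] by (simp add: m_def[symmetric] mu.prob_space)
    also have "\<dots> \<le> (\<integral>x. exp (- W x y) \<partial>gibbs lam U)"
    proof (rule integral_mono)
      fix x
      have "1 + (m - W x y) \<le> exp (m - W x y)" by (rule exp_ge_add_one_self)
      then have "exp (- m) * (1 + (m - W x y)) \<le> exp (- m) * exp (m - W x y)"
        by (intro mult_left_mono) auto
      then show "exp (- m) * (1 + m - W x y) \<le> exp (- W x y)"
        by (simp add: exp_add[symmetric] add_diff_eq)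
    qed (use int_W_U int_e in auto)
    also have "\<dots> = (\<integral>x. exp (- W x y) * exp (- U x) \<partial>lam)"
      unfolding gibbs_def by (subst integral_density) (auto simp: mult.commute)
    finally have jensen: "exp (- m) \<le> (\<integral>x. exp (- W x y) * exp (- U x) \<partial>lam)" .
    have "exp (- \<delta> * V y) * exp (- t - C) \<le> exp (- C) * exp (- m)"
      using mean_U[of y] by (simp add: m_def exp_add[symmetric])
    also have "\<dots> \<le> exp (- C) * (\<integral>x. exp (- W x y) * exp (- U x) \<partial>lam)"
      using jensen by simp
    also have "\<dots> = (\<integral>x. exp (- C) * (exp (- W x y) * exp (- U x)) \<partial>lam)" by simp
    also have "\<dots> \<le> K_flat lam W (\<lambda>x. exp (- F x)) y"
      unfolding K_flat_def
    proof (rule integral_mono)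
      have "integrable (gibbs lam U) (\<lambda>x. exp (- W x y)) \<longleftrightarrow> integrable lam (\<lambda>x. exp (- U x) *\<^sub>R exp (- W x y))"
        unfolding gibbs_def by (rule integrable_density) auto
      then show "integrable lam (\<lambda>x. exp (- C) * (exp (- W x y) * exp (- U x)))"
        using int_e by (simp add: mult.commute)
      show "exp (- C) * (exp (- W x y) * exp (- U x)) \<le> exp (- W x y) * exp (- F x)" for x
        using C(2)[of x] by (simp add: exp_add[symmetric])
    qed (rule tame_integrable[OF assms])
    finally show ?thesis .
  qed
  \<comment> \<open>One constant for both bounds: it dominates \<open>C1\<close>, and its inverse is
    at most \<open>exp (- t - C)\<close>.\<close>
  define D where "D = max (max C1 1) (exp (t + C))"
  have "exp (- \<delta> * V y) / D \<le> exp (- \<delta> * V y) * exp (- t - C)" for y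
  proof -
    have "exp (- \<delta> * V y) / D \<le> exp (- \<delta> * V y) / exp (t + C)"
      by (intro divide_left_mono mult_pos_pos) (auto simp: D_def)
    also have "\<dots> = exp (- \<delta> * V y) * exp (- t - C)"
      by (simp add: exp_diff[symmetric] exp_add[symmetric])
    finally show ?thesis .
  qed
  then have "exp (- \<delta> * V y) / D \<le> K_flat lam W (\<lambda>x. exp (- F x)) y" for y
    using low order_trans by blast
  moreover have "K_flat lam W (\<lambda>x. exp (- F x)) y \<le> D" for y
    using up[of y] by (simp add: D_def)
  moreover have "D > 0" by (simp add: D_def)
  ultimately show ?thesis by (intro that[of D])
qed

lemma K_flat_pos:
  assumes "tame \<delta> U F"
  shows "0 < K_flat lam W (\<lambda>x. exp (- F x)) y"
proof -
  from K_flat_bounds[OF assms] obtain C where "C > 0"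
    "\<And>y. exp (- \<delta> * V y) / C \<le> K_flat lam W (\<lambda>x. exp (- F x)) y" by metis
  then show ?thesis by (meson divide_pos_pos exp_gt_zero less_le_trans)
qed

text \<open>Taking logarithms in \<open>K_flat_bounds\<close> gives a correction between
  \<open>- \<delta> * V y - ln C\<close> and \<open>ln C\<close>, so the same \<delta> persists. The
  additive constant may change at each step; this is harmless, since tameness only serves
  measurability, positivity and finiteness, never the rate.\<close>

lemma tame_next:
  assumes "tame \<delta> U F"
  shows "tame \<delta> V (\<lambda>y. V y + ln (K_flat lam W (\<lambda>x. exp (- F x)) y))"
proof -
  from assms have [measurable]: "F \<in> borel_measurable borel" unfolding tame_def by blast
  have [measurable]: "K_flat lam W (\<lambda>x. exp (- F x)) \<in> borel_measurable borel"
    by (rule K_flat_measurable) measurable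
  from K_flat_bounds[OF assms] obtain C where C: "C > 0"
    "\<And>y. K_flat lam W (\<lambda>x. exp (- F x)) y \<le> C"
    "\<And>y. exp (- \<delta> * V y) / C \<le> K_flat lam W (\<lambda>x. exp (- F x)) y" by blast
  have "ln (K_flat lam W (\<lambda>x. exp (- F x)) y) \<le> ln C" for y
    using C(1,2) K_flat_pos[OF assms] by (subst ln_le_cancel_iff) auto
  moreover have "- \<delta> * V y - ln C \<le> ln (K_flat lam W (\<lambda>x. exp (- F x)) y)" for y
  proof -
    have "ln (exp (- \<delta> * V y) / C) \<le> ln (K_flat lam W (\<lambda>x. exp (- F x)) y)"
      using C K_flat_pos[OF assms] by (subst ln_le_cancel_iff) auto
    then show ?thesis using C(1) by (simp add: ln_div)
  qed
  ultimately have "(1 - \<delta>) * V y - ln C \<le> V y + ln (K_flat lam W (\<lambda>x. exp (- F x)) y)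
      \<and> V y + ln (K_flat lam W (\<lambda>x. exp (- F x)) y) \<le> V y + ln C" for y
    by (simp add: left_diff_distrib)
  then show ?thesis
    unfolding tame_def by (intro conjI exI[of _ "ln C"]) auto
qed

lemma sinkhorn_kernel_measurable:
  assumes "tame \<delta> U F"
  shows "sinkhorn_kernel lam W F \<in> measurable borel (subprob_algebra borel)"
    and "prob_space (sinkhorn_kernel lam W F y)"
proof -
  interpret sigma_finite_measure lam by (rule sigma_finite_lam)
  from assms have [measurable]: "F \<in> borel_measurable borel" unfolding tame_def by blast
  have [measurable]: "K_flat lam W (\<lambda>x. exp (- F x)) \<in> borel_measurable borel"
    by (rule K_flat_measurable) measurable
  let ?k = "K_flat lam W (\<lambda>x. exp (- F x))"
  have prob: "prob_space (sinkhorn_kernel lam W F y)" for y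
  proof (rule prob_spaceI)
    have k: "0 < ?k y" by (rule K_flat_pos[OF assms])
    have "emeasure (sinkhorn_kernel lam W F y) (space (sinkhorn_kernel lam W F y))
        = (\<integral>\<^sup>+x. ennreal (exp (- W x y) * exp (- F x) / ?k y) \<partial>lam)"
      unfolding sinkhorn_kernel_def using space_lam
      by (simp add: emeasure_density exp_add[symmetric])
    also have "\<dots> = ennreal (\<integral>x. exp (- W x y) * exp (- F x) / ?k y \<partial>lam)"
      using tame_integrable[OF assms, of y] k
      by (intro nn_integral_eq_integral) auto
    also have "(\<integral>x. exp (- W x y) * exp (- F x) / ?k y \<partial>lam) = 1"
      using k by (simp add: K_flat_def)
    finally show "emeasure (sinkhorn_kernel lam W F y) (space (sinkhorn_kernel lam W F y)) = 1"
      by simp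
  qed
  then show "prob_space (sinkhorn_kernel lam W F y)" .
  show "sinkhorn_kernel lam W F \<in> measurable borel (subprob_algebra borel)"
  proof (rule measurable_subprob_algebra)
    show "subprob_space (sinkhorn_kernel lam W F y)" for y
      by (rule prob_space_imp_subprob_space[OF prob])
    show "sets (sinkhorn_kernel lam W F y) = sets borel" for y
      by (simp add: sinkhorn_kernel_def sets_lam)
    fix A :: "'a set" assume [measurable]: "A \<in> sets borel"
    have "(\<lambda>y. emeasure (sinkhorn_kernel lam W F y) A)
        = (\<lambda>y. \<integral>\<^sup>+x. ennreal (exp (- W x y - F x) / ?k y) * indicator A x \<partial>lam)"
      unfolding sinkhorn_kernel_def by (intro ext emeasure_density) auto
    then show "(\<lambda>y. emeasure (sinkhorn_kernel lam W F y) A) \<in> borel_measurable borel"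
      by simp
  qed
qed

section \<open>Marginals of the joint Gibbs density\<close>

text \<open>Consider the joint density \<open>exp (- W x y - F x - G y)\<close>. The initial measure
  is its marginal on the second space and the kernel is its conditional law of \<open>x\<close>
  given \<open>y\<close>, so by Tonelli the result is its marginal on the first space.\<close>

lemma bind_sinkhorn_kernel:
  assumes F: "tame \<delta> U F" and G: "tame \<delta> V G"
  shows "density nu (\<lambda>y. ennreal (exp (- G y) * K_flat lam W (\<lambda>x. exp (- F x)) y))
           \<bind> sinkhorn_kernel lam W F
         = density lam (\<lambda>x. ennreal (exp (- F x) * K_op nu W (\<lambda>y. exp (- G y)) x))"
    (is "_ = ?N")
proof -
  let ?M = "density nu (\<lambda>y. ennreal (exp (- G y) * K_flat lam W (\<lambda>x. exp (- F x)) y))"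
  interpret sw: gibbs_pair nu lam V U "\<lambda>y x. W x y" \<delta> b w t by (rule swap)
  interpret pair_sigma_finite lam nu
    unfolding pair_sigma_finite_def using sigma_finite_lam sw.sigma_finite_lam by simp
  from F G have [measurable]: "F \<in> borel_measurable borel" "G \<in> borel_measurable borel"
    unfolding tame_def by auto
  let ?k = "K_flat lam W (\<lambda>x. exp (- F x))" and ?l = "K_op nu W (\<lambda>y. exp (- G y))"
  have [measurable]: "?k \<in> borel_measurable borel" "?l \<in> borel_measurable borel"
    unfolding K_op_eq_K_flat by (rule K_flat_measurable sw.K_flat_measurable; measurable)+
  have ker: "sinkhorn_kernel lam W F \<in> measurable ?M (subprob_algebra borel)"
    using sinkhorn_kernel_measurable(1)[OF F] sets_nu by (simp cong: measurable_cong_sets)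
  have ne: "space ?M \<noteq> {}" using sw.space_lam by simp
  have k: "0 < ?k y" for y by (rule K_flat_pos[OF F])
  show ?thesis
  proof (rule measure_eqI)
    show sets: "sets (?M \<bind> sinkhorn_kernel lam W F) = sets ?N"
      using sets_bind_measurable[OF ker ne] by (simp add: sets_lam)
    fix A assume "A \<in> sets (?M \<bind> sinkhorn_kernel lam W F)"
    then have A[measurable]: "A \<in> sets borel" using sets sets_lam by simp
    have "emeasure (?M \<bind> sinkhorn_kernel lam W F) A
        = (\<integral>\<^sup>+y. emeasure (sinkhorn_kernel lam W F y) A \<partial>?M)"
      by (rule emeasure_bind[OF ne ker A])
    also have "\<dots> = (\<integral>\<^sup>+y. (\<integral>\<^sup>+x. ennreal (exp (- W x y - F x) / ?k y) * indicator A x \<partial>lam) \<partial>?M)"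
      unfolding sinkhorn_kernel_def by (intro nn_integral_cong emeasure_density) auto
    also have "\<dots> = (\<integral>\<^sup>+y. ennreal (exp (- G y) * ?k y)
        * (\<integral>\<^sup>+x. ennreal (exp (- W x y - F x) / ?k y) * indicator A x \<partial>lam) \<partial>nu)"
      by (rule nn_integral_density) auto
    also have "\<dots> = (\<integral>\<^sup>+y. (\<integral>\<^sup>+x. ennreal (exp (- W x y - F x - G y)) * indicator A x \<partial>lam) \<partial>nu)"
    proof (rule nn_integral_cong)
      fix y
      have "ennreal (exp (- G y) * ?k y) * ennreal (exp (- W x y - F x) / ?k y)
          = ennreal (exp (- W x y - F x - G y))" for x
        using k[of y] by (simp add: ennreal_mult'[symmetric] exp_add[symmetric])
      then show "ennreal (exp (- G y) * ?k y)
          * (\<integral>\<^sup>+x. ennreal (exp (- W x y - F x) / ?k y) * indicator A x \<partial>lam)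
        = (\<integral>\<^sup>+x. ennreal (exp (- W x y - F x - G y)) * indicator A x \<partial>lam)"
        by (subst nn_integral_cmult[symmetric]) (auto simp: mult.assoc[symmetric])
    qed
    also have "\<dots> = (\<integral>\<^sup>+x. (\<integral>\<^sup>+y. ennreal (exp (- W x y - F x - G y)) * indicator A x \<partial>nu) \<partial>lam)"
      by (rule Fubini') measurable
    also have "\<dots> = (\<integral>\<^sup>+x. ennreal (exp (- F x) * ?l x) * indicator A x \<partial>lam)"
    proof (rule nn_integral_cong)
      fix x
      have "- W x y - F x - G y = - F x + (- W x y + - G y)" for y by simp
      then have "(\<integral>\<^sup>+y. ennreal (exp (- W x y - F x - G y)) \<partial>nu)
          = (\<integral>\<^sup>+y. ennreal (exp (- F x)) * ennreal (exp (- W x y) * exp (- G y)) \<partial>nu)"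
        by (simp only: exp_add ennreal_mult' exp_ge_zero mult_nonneg_nonneg)
      also have "\<dots> = ennreal (exp (- F x)) * (\<integral>\<^sup>+y. ennreal (exp (- W x y) * exp (- G y)) \<partial>nu)"
        by (rule nn_integral_cmult) measurable
      also have "(\<integral>\<^sup>+y. ennreal (exp (- W x y) * exp (- G y)) \<partial>nu) = ennreal (?l x)"
        unfolding K_op_def using sw.tame_integrable[OF G, of x]
        by (intro nn_integral_eq_integral) auto
      finally show "(\<integral>\<^sup>+y. ennreal (exp (- W x y - F x - G y)) * indicator A x \<partial>nu)
          = ennreal (exp (- F x) * ?l x) * indicator A x"
        by (simp add: nn_integral_multc ennreal_mult')
    qed
    finally show "emeasure (?M \<bind> sinkhorn_kernel lam W F) A = emeasure ?N A"
      by (simp add: emeasure_density)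
  qed
qed

text \<open>This \<open>G\<close> is the potential for which the second marginal of the joint
  density is exactly \<eta>. The right-hand side therefore gives the density of an odd
  iterate.\<close>

lemma target_bind_sinkhorn_kernel:
  assumes F: "tame \<delta> U F" and G: "G = (\<lambda>y. V y + ln (K_flat lam W (\<lambda>x. exp (- F x)) y))"
  shows "gibbs nu V \<bind> sinkhorn_kernel lam W F
         = density lam (\<lambda>x. ennreal (exp (- F x) * K_op nu W (\<lambda>y. exp (- G y)) x))"
proof -
  have "exp (- G y) * K_flat lam W (\<lambda>x. exp (- F x)) y = exp (- V y)" for y
    using K_flat_pos[OF F, of y] by (simp add: G exp_diff exp_minus exp_add field_simps)
  then show ?thesis
    using bind_sinkhorn_kernel[OF F tame_next[OF F]] by (simp add: gibbs_def G)
qed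

text \<open>Here \<open>F\<close> is instead chosen so that the first marginal of the joint density
  is \<mu>: the previous even iterate is carried to the target by the very kernel that produces the
  next odd iterate from \<eta>.\<close>

lemma iterate_bind_sinkhorn_kernel:
  assumes G: "tame \<delta> V G" and F: "F = (\<lambda>x. U x + ln (K_op nu W (\<lambda>y. exp (- G y)) x))"
  shows "density nu (\<lambda>y. ennreal (exp (- G y) * K_flat lam W (\<lambda>x. exp (- F x)) y))
           \<bind> sinkhorn_kernel lam W F = gibbs lam U"
proof -
  interpret sw: gibbs_pair nu lam V U "\<lambda>y x. W x y" \<delta> b w t by (rule swap)
  have "exp (- F x) * K_op nu W (\<lambda>y. exp (- G y)) x = exp (- U x)" for x
    using sw.K_flat_pos[OF G, of x]
    by (simp add: F K_op_eq_K_flat exp_diff exp_minus exp_add field_simps)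
  then show ?thesis
    using bind_sinkhorn_kernel[OF sw.tame_next[OF G, folded K_op_eq_K_flat, folded F] G]
    by (simp add: gibbs_def)
qed

text \<open>\<open>p\<close> is the density of the image of \<eta> under a Markov kernel, hence of a
  probability measure. Tameness of \<open>F\<close> together with the upper bound on
  \<open>K_op\<close> puts it within reach of \<open>weight_finite\<close>.\<close>

lemma sinkhorn_density:
  assumes F: "tame \<delta> U F" and G: "G = (\<lambda>y. V y + ln (K_flat lam W (\<lambda>x. exp (- F x)) y))"
  defines "p \<equiv> (\<lambda>x. exp (- F x) * K_op nu W (\<lambda>y. exp (- G y)) x)"
  shows "p \<in> borel_measurable borel" "0 \<le> p x" "integrable lam p" "prob_space (density lam p)"
    and "0 \<le> a \<Longrightarrow> (\<integral>\<^sup>+x. ennreal (p x) * ennreal (1/2 + a * exp (\<delta> * U x)) \<partial>lam) < \<infinity>"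
proof -
  interpret sw: gibbs_pair nu lam V U "\<lambda>y x. W x y" \<delta> b w t by (rule swap)
  have tG: "tame \<delta> V G" unfolding G by (rule tame_next[OF F])
  from F tG have [measurable]: "F \<in> borel_measurable borel" "G \<in> borel_measurable borel"
    unfolding tame_def by auto
  have [measurable]: "K_op nu W (\<lambda>y. exp (- G y)) \<in> borel_measurable borel"
    unfolding K_op_eq_K_flat by (rule sw.K_flat_measurable) measurable
  show p: "p \<in> borel_measurable borel" unfolding p_def by measurable
  from sw.K_flat_bounds[OF tG] obtain D where
    D: "D > 0" "\<And>x. K_op nu W (\<lambda>y. exp (- G y)) x \<le> D"
    unfolding K_op_eq_K_flat by metis
  have pos: "0 \<le> K_op nu W (\<lambda>y. exp (- G y)) x" for x
    unfolding K_op_eq_K_flat using sw.K_flat_pos[OF tG] by (rule less_imp_le)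
  then show p0: "0 \<le> p x" for x unfolding p_def by simp
  from F obtain C where C: "\<And>x. (1 - \<delta>) * U x - C \<le> F x" unfolding tame_def by blast
  have le: "p x \<le> (exp C * D) * exp (- (1 - \<delta>) * U x)" for x
  proof -
    have "exp (- F x) \<le> exp C * exp (- (1 - \<delta>) * U x)"
      using C[of x] by (simp add: exp_add[symmetric] algebra_simps)
    then have "p x \<le> (exp C * exp (- (1 - \<delta>) * U x)) * D"
      unfolding p_def using D pos by (intro mult_mono) auto
    then show ?thesis by (simp add: mult_ac)
  qed
  show "integrable lam p" by (rule weight_finite(2)[OF p le p0 order_refl])
  show "(\<integral>\<^sup>+x. ennreal (p x) * ennreal (1/2 + a * exp (\<delta> * U x)) \<partial>lam) < \<infinity>" if "0 \<le> a"
    by (rule weight_finite(1)[OF p le p0 that])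
  show "prob_space (density lam p)"
    unfolding p_def target_bind_sinkhorn_kernel[OF F G, symmetric]
  proof (rule prob_space.prob_space_bind[OF prob_V])
    show "AE y in gibbs nu V. prob_space (sinkhorn_kernel lam W F y)"
      by (intro AE_I2 sinkhorn_kernel_measurable(2)[OF F])
    show "sinkhorn_kernel lam W F \<in> measurable (gibbs nu V) (subprob_algebra borel)"
      using sinkhorn_kernel_measurable(1)[OF F] sets_nu
      by (simp add: gibbs_def cong: measurable_cong_sets)
  qed
qed

lemma gibbs_density:
  shows "integrable lam (\<lambda>x. exp (- U x))"
    and "0 \<le> a \<Longrightarrow> (\<integral>\<^sup>+x. ennreal (exp (- U x)) * ennreal (1/2 + a * exp (\<delta> * U x)) \<partial>lam) < \<infinity>"
proof -
  have le: "exp (- U x) \<le> exp (- \<delta> * b) * exp (- (1 - \<delta>) * U x)" for x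
    using U_ge[of x] \<delta> by (simp add: exp_add[symmetric] algebra_simps)
  show "integrable lam (\<lambda>x. exp (- U x))"
    by (rule weight_finite(2)[OF _ le _ order_refl]) auto
  show "(\<integral>\<^sup>+x. ennreal (exp (- U x)) * ennreal (1/2 + a * exp (\<delta> * U x)) \<partial>lam) < \<infinity>" if "0 \<le> a"
    by (rule weight_finite(1)[OF _ le _ that]) auto
qed

text \<open>Base case of the recursion, where the potential is \<open>U\<close> itself; the lower
  bound on \<open>U\<close> supplies the constant.\<close>

lemma tame_self: "tame \<delta> U U"
proof -
  have "(1 - \<delta>) * U x - \<bar>\<delta> * b\<bar> \<le> U x \<and> U x \<le> U x + \<bar>\<delta> * b\<bar>" for x
  proof -
    have "\<delta> * b \<le> \<delta> * U x" using U_ge[of x] \<delta> by (intro mult_left_mono) auto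
    then have "- \<bar>\<delta> * b\<bar> \<le> \<delta> * U x" by linarith
    then show ?thesis by (simp add: left_diff_distrib)
  qed
  then show ?thesis
    unfolding tame_def using U_borel by blast
qed

end

section \<open>One half step: contraction and transport cost\<close>

text \<open>One kernel sends the previous iterate to \<mu> and \<eta> to the next iterate. Its
  Lipschitz constant thus compares the new distance to \<mu> with the old distance to
  \<eta>.\<close>

lemma (in gibbs_pair) contraction:
  assumes G0: "tame \<delta> V G0" and F: "F = (\<lambda>x. U x + ln (K_op nu W (\<lambda>y. exp (- G0 y)) x))"
    and G: "G = (\<lambda>y. V y + ln (K_flat lam W (\<lambda>x. exp (- F x)) y))"
    and a: "0 \<le> a"
    and lip: "lip (\<lambda>y. 1/2 + a * exp (\<delta> * V y)) (\<lambda>x. 1/2 + a * exp (\<delta> * U x))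
        (sinkhorn_kernel lam W F) \<le> ennreal \<rho>"
  shows "(\<integral>\<^sup>+x. ennreal \<bar>exp (- F x) * K_op nu W (\<lambda>y. exp (- G y)) x - exp (- U x)\<bar>
            * ennreal (1/2 + a * exp (\<delta> * U x)) \<partial>lam)
    \<le> ennreal \<rho> * (\<integral>\<^sup>+y. ennreal \<bar>exp (- G0 y) * K_flat lam W (\<lambda>x. exp (- F x)) y - exp (- V y)\<bar>
            * ennreal (1/2 + a * exp (\<delta> * V y)) \<partial>nu)"
proof -
  interpret sw: gibbs_pair nu lam V U "\<lambda>y x. W x y" \<delta> b w t by (rule swap)
  have F': "F = (\<lambda>x. U x + ln (K_flat nu (\<lambda>y x. W x y) (\<lambda>y. exp (- G0 y)) x))"
    using F by (simp add: K_op_eq_K_flat)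
  have tF: "tame \<delta> U F" unfolding F' by (rule sw.tame_next[OF G0])
  have op: "K_op lam (\<lambda>y x. W x y) f = K_flat lam W f" for f by (simp add: K_op_eq_K_flat)
  \<comment> \<open>\<open>pi\<close> describes the new iterate on the first space;
    \<open>pi'\<close>, taken from the exchanged locale, describes the previous iterate on the
    second.\<close>
  note pi = sinkhorn_density[OF tF G]
  note pi' = sw.sinkhorn_density[OF G0 F', unfolded op]
  have "(\<integral>\<^sup>+x. ennreal \<bar>exp (- U x) - exp (- F x) * K_op nu W (\<lambda>y. exp (- G y)) x\<bar>
            * ennreal (1/2 + a * exp (\<delta> * U x)) \<partial>lam)
    \<le> ennreal \<rho> * (\<integral>\<^sup>+y. ennreal \<bar>exp (- G0 y) * K_flat lam W (\<lambda>x. exp (- F x)) y - exp (- V y)\<bar>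
            * ennreal (1/2 + a * exp (\<delta> * V y)) \<partial>nu)"
  proof (rule lip_step[OF sets_nu sets_lam pi'(4) _ pi'(3) sw.gibbs_density(1) gibbs_density(1)
        pi(3) pi'(2) _ _ pi(2) _ _ _ _ lip pi'(5)[OF a] sw.gibbs_density(2)[OF a]])
    show "prob_space (density nu (\<lambda>y. ennreal (exp (- V y))))"
      using prob_V by (simp add: gibbs_def)
    show "density nu (\<lambda>y. ennreal (exp (- G0 y) * K_flat lam W (\<lambda>x. exp (- F x)) y))
        \<bind> sinkhorn_kernel lam W F = density lam (\<lambda>x. ennreal (exp (- U x)))"
      using iterate_bind_sinkhorn_kernel[OF G0 F] by (simp add: gibbs_def)
    show "density nu (\<lambda>y. ennreal (exp (- V y))) \<bind> sinkhorn_kernel lam W F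
        = density lam (\<lambda>x. ennreal (exp (- F x) * K_op nu W (\<lambda>y. exp (- G y)) x))"
      using target_bind_sinkhorn_kernel[OF tF G] by (simp add: gibbs_def)
  qed auto
  then show ?thesis by (simp add: abs_minus_commute)
qed

lemma semi_distance_measurable:
  fixes \<psi> :: "'a::topological_space \<Rightarrow> 'a \<Rightarrow> real"
  assumes "semi_distance \<psi>"
  shows "(\<lambda>z. \<psi> (fst z) (snd z)) \<in> borel_measurable borel"
  using assms unfolding semi_distance_def borel_measurable_iff_le by (auto intro: borel_closed)

lemma (in gibbs_pair) transport_cost_le:
  assumes F: "tame \<delta> U F" and G: "G = (\<lambda>y. V y + ln (K_flat lam W (\<lambda>x. exp (- F x)) y))"
    and a: "0 < a" and psi: "semi_distance \<psi>"
    and le: "\<And>x y. \<psi> x y \<le> exp (\<delta> * U x) + exp (\<delta> * U y)"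
  shows "transport_cost \<psi> (gibbs nu V \<bind> sinkhorn_kernel lam W F) (gibbs lam U)
    \<le> ennreal (1 / a) *
      (\<integral>\<^sup>+x. ennreal \<bar>exp (- F x) * K_op nu W (\<lambda>y. exp (- G y)) x - exp (- U x)\<bar>
          * ennreal (1/2 + a * exp (\<delta> * U x)) \<partial>lam)"
proof -
  define p where "p = (\<lambda>x. exp (- F x) * K_op nu W (\<lambda>y. exp (- G y)) x)"
  have [measurable]: "p \<in> borel_measurable borel" and p0: "0 \<le> p x"
    and prob: "prob_space (density lam p)" for x
    unfolding p_def by (rule sinkhorn_density[OF F G])+
  have "transport_cost \<psi> (gibbs nu V \<bind> sinkhorn_kernel lam W F) (gibbs lam U)
      = transport_cost \<psi> (density lam p) (density lam (\<lambda>x. exp (- U x)))"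
    using target_bind_sinkhorn_kernel[OF F G] by (simp add: gibbs_def p_def)
  also have "\<dots> \<le> (\<integral>\<^sup>+x. ennreal \<bar>p x - exp (- U x)\<bar> * ennreal (exp (\<delta> * U x)) \<partial>lam)"
    using psi le prob_U
    by (intro transport_cost_density_le sets_lam p0 prob semi_distance_measurable)
      (auto simp: semi_distance_def gibbs_def)
  also have "\<dots> \<le> (\<integral>\<^sup>+x. ennreal (1 / a) * (ennreal \<bar>p x - exp (- U x)\<bar>
      * ennreal (1/2 + a * exp (\<delta> * U x))) \<partial>lam)"
  proof (rule nn_integral_mono)
    \<comment> \<open>This comparison of \<open>exp (\<delta> * U x)\<close> with the full weight is
      the source of the factor \<open>1 / a\<close> in the final estimate.\<close>
    fix x
    have "exp (\<delta> * U x) \<le> 1 / a * (1/2 + a * exp (\<delta> * U x))"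
      using a by (simp add: field_simps)
    then have "\<bar>p x - exp (- U x)\<bar> * exp (\<delta> * U x)
        \<le> \<bar>p x - exp (- U x)\<bar> * (1 / a * (1/2 + a * exp (\<delta> * U x)))"
      by (rule mult_left_mono) simp
    then have "ennreal (\<bar>p x - exp (- U x)\<bar> * exp (\<delta> * U x))
        \<le> ennreal (1 / a * (\<bar>p x - exp (- U x)\<bar> * (1/2 + a * exp (\<delta> * U x))))"
      by (intro ennreal_leI) (simp add: mult_ac)
    then show "ennreal \<bar>p x - exp (- U x)\<bar> * ennreal (exp (\<delta> * U x))
        \<le> ennreal (1 / a) * (ennreal \<bar>p x - exp (- U x)\<bar> * ennreal (1/2 + a * exp (\<delta> * U x)))"
      using a by (simp add: ennreal_mult[symmetric] del: ennreal_plus)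
  qed
  also have "\<dots> = ennreal (1 / a) * (\<integral>\<^sup>+x. ennreal \<bar>p x - exp (- U x)\<bar>
      * ennreal (1/2 + a * exp (\<delta> * U x)) \<partial>lam)"
    by (rule nn_integral_cmult) measurable
  finally show ?thesis unfolding p_def .
qed

section \<open>The Sinkhorn sequence\<close>

text \<open>Finitely many neighbourhoods on which \<open>f\<close> is bounded cover the compact set
  where \<open>f\<close> is at most 0; elsewhere \<open>f\<close> is positive.\<close>

lemma compact_sublevel_bounded_below:
  fixes f :: "'a::topological_space \<Rightarrow> real"
  assumes "locally_bounded f" and K: "compact {x. f x \<le> 0}"
  obtains b where "\<And>x. b \<le> f x"
proof -
  from assms obtain S where S: "\<And>x. open (S x)" "\<And>x. x \<in> S x" "\<And>x. bounded (f ` S x)"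
    unfolding locally_bounded_def by metis
  have cov: "{x. f x \<le> 0} \<subseteq> (\<Union>x\<in>UNIV. S x)" using S(2) by blast
  obtain C where C: "finite C" "{x. f x \<le> 0} \<subseteq> (\<Union>x\<in>C. S x)"
    by (rule compactE_image[OF K _ cov]) (use S(1) in auto)
  have "bounded (\<Union>x\<in>C. f ` S x)" using C(1) S(3) by (intro bounded_UN) auto
  then obtain B where B: "\<And>r. r \<in> (\<Union>x\<in>C. f ` S x) \<Longrightarrow> \<bar>r\<bar> \<le> B" unfolding bounded_iff by auto
  \<comment> \<open>The absolute value covers an empty sub-level set, where nothing fixes the sign
    of \<open>B\<close>.\<close>
  have "- \<bar>B\<bar> \<le> f x" for x
  proof (cases "f x \<le> 0")
    case True
    then have "\<bar>f x\<bar> \<le> B" using C(2) by (intro B) blast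
    then show ?thesis by linarith
  qed simp
  then show ?thesis by (rule that)
qed

lemma compact_sublevel_measurable:
  fixes f :: "'a::t2_space \<Rightarrow> real"
  assumes "\<And>r. compact {x. f x \<le> r}"
  shows "f \<in> borel_measurable borel"
  unfolding borel_measurable_iff_le using assms by (auto intro: borel_closed compact_imp_closed)

lemma B0_bound:
  assumes "\<theta> \<in> B0" and le: "\<And>x. exp (- (u x - m x)) \<le> \<theta> x"
  obtains t where "\<And>x. m x \<le> u x + t"
proof -
  from assms(1) obtain T where T: "\<And>x. \<bar>\<theta> x\<bar> \<le> T" unfolding B0_def bounded_iff by auto
  have "m x \<le> u x + ln (\<bar>T\<bar> + 1)" for x
  proof -
    have "exp (- (u x - m x)) \<le> \<bar>T\<bar> + 1" using le[of x] T[of x] by linarith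
    then have "- (u x - m x) \<le> ln (\<bar>T\<bar> + 1)" by (subst ln_ge_iff) auto
    then show ?thesis by simp
  qed
  then show ?thesis by (rule that)
qed

text \<open>\<open>b\<close> comes from the compact sub-level sets, \<open>w\<close> from the
  supremum of \<open>exp (- W)\<close>, and \<open>t\<close> from the logarithms of bounds on the
  dominating functions in condition (A). Maxima and minima give one triple valid on both
  sides.\<close>

lemma gibbs_pairI:
  assumes "sinkhorn_setting lam nu U V W" and A: "condition_A lam nu U V W \<delta>"
  obtains b w t where "gibbs_pair lam nu U V W \<delta> b w t"
proof -
  interpret sinkhorn_setting lam nu U V W by fact
  obtain b1 where b1: "\<And>x. b1 \<le> U x"
    using compact_sublevel_bounded_below[OF U_locally_bounded U_compact_sublevel] by blast
  obtain b2 where b2: "\<And>y. b2 \<le> V y"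
    using compact_sublevel_bounded_below[OF V_locally_bounded V_compact_sublevel] by blast
  obtain w where w: "\<And>x y. exp (- W x y) \<le> w"
    using exp_W_bounded unfolding bdd_above_def by auto
  from A obtain \<theta>u \<theta>v where th: "\<theta>u \<in> B0" "\<theta>v \<in> B0"
    "\<And>x. exp (- (\<delta> * U x - mean_Y nu V W x)) \<le> \<theta>u x"
    "\<And>y. exp (- (\<delta> * V y - mean_X lam U W y)) \<le> \<theta>v y"
    unfolding condition_A_def by blast
  obtain t1 where t1: "\<And>x. mean_Y nu V W x \<le> \<delta> * U x + t1" using B0_bound[OF th(1,3)] by blast
  obtain t2 where t2: "\<And>y. mean_X lam U W y \<le> \<delta> * V y + t2" using B0_bound[OF th(2,4)] by blast
  have "gibbs_pair lam nu U V W \<delta> (min b1 b2) w (max t1 t2)"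
  proof (rule gibbs_pair.intro)
    show "sets lam = sets borel" "sets nu = sets borel"
      using lam nu unfolding locally_bounded_measure_def by auto
    show "U \<in> borel_measurable borel" "V \<in> borel_measurable borel"
      using U_compact_sublevel V_compact_sublevel by (auto intro: compact_sublevel_measurable)
    show "min b1 b2 \<le> U x" "min b1 b2 \<le> V y" for x y
      using b1[of x] b2[of y] by auto
    show "(\<integral>x. W x y \<partial>gibbs lam U) \<le> \<delta> * V y + max t1 t2" for y
      using t2[of y] unfolding mean_X_def by linarith
    show "(\<integral>y. W x y \<partial>gibbs nu V) \<le> \<delta> * U x + max t1 t2" for x
      using t1[of x] unfolding mean_Y_def by linarith
  qed (use A W_measurable w prob_mu prob_eta in \<open>auto simp: condition_A_def\<close>)
  then show ?thesis by (rule that)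
qed

lemma trans_odd_eq:
  "trans_odd lam nu U V W m = sinkhorn_kernel lam W (sinkhorn_U lam nu U V W m)"
  by (simp add: fun_eq_iff trans_odd_def sinkhorn_kernel_def Let_def)

lemma trans_even_eq:
  "trans_even lam nu U V W m = sinkhorn_kernel nu (\<lambda>y x. W x y) (sinkhorn_V lam nu U V W m)"
  by (simp add: fun_eq_iff trans_even_def sinkhorn_kernel_def Let_def K_op_eq_K_flat)

section \<open>Alternating half steps and the geometric rate\<close>

theorem corollary5p25:
  fixes lam :: "'a::polish_space measure" and nu :: "'b::polish_space measure"
    and U :: "'a \<Rightarrow> real" and V :: "'b \<Rightarrow> real" and W :: "'a \<Rightarrow> 'b \<Rightarrow> real"
    and g :: "'a \<Rightarrow> real" and h :: "'b \<Rightarrow> real"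
    and g_a :: "'a \<Rightarrow> real" and h_a :: "'b \<Rightarrow> real"
    and \<psi>g :: "'a \<Rightarrow> 'a \<Rightarrow> real" and \<psi>h :: "'b \<Rightarrow> 'b \<Rightarrow> real"
    and \<delta> a \<rho> :: real
  assumes "sinkhorn_setting lam nu U V W"
    and "condition_A lam nu U V W \<delta>"
    and "g = (\<lambda>x. exp (\<delta> * U x))" and "h = (\<lambda>y. exp (\<delta> * V y))"
    and "a > 0" and "0 < \<rho>" and "\<rho> < 1"
    and "g_a = (\<lambda>x. 1/2 + a * g x)" and "h_a = (\<lambda>y. 1/2 + a * h y)"
    and "\<And>n. n \<ge> 1 \<Longrightarrow>
           max (lip g_a h_a (trans_even lam nu U V W (2 * n)))
               (lip h_a g_a (trans_odd lam nu U V W (2 * n + 1))) \<le> ennreal \<rho>"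
    and "semi_distance \<psi>g" and "semi_distance \<psi>h"
    and "\<And>x1 x2. \<psi>g x1 x2 \<le> g x1 + g x2"
    and "\<And>y1 y2. \<psi>h y1 y2 \<le> h y1 + h y2"
  shows "\<exists>c>0. \<forall>n\<ge>1.
           max (transport_cost \<psi>g (pi_odd lam nu U V W (2 * n + 1)) (gibbs lam U))
               (transport_cost \<psi>h (pi_even lam nu U V W (2 * (n + 1))) (gibbs nu V))
             \<le> ennreal (c / a * \<rho> ^ (2 * n))"
proof -
  obtain b w t where "gibbs_pair lam nu U V W \<delta> b w t"
    using gibbs_pairI[OF assms(1,2)] by blast
  then interpret X: gibbs_pair lam nu U V W \<delta> b w t .
  interpret Y: gibbs_pair nu lam V U "\<lambda>y x. W x y" \<delta> b w t by (rule X.swap)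
  \<comment> \<open>Each potential is constant over two consecutive indices, so \<open>F n\<close>
    drives the transition of index \<open>2 * n + 1\<close> and \<open>G n\<close> the one of index
    \<open>2 * n + 2\<close>.\<close>
  define F where "F n = sinkhorn_U lam nu U V W (2 * n)" for n
  define G where "G n = sinkhorn_V lam nu U V W (2 * n + 1)" for n
  have op: "K_op lam (\<lambda>y x. W x y) f = K_flat lam W f" for f by (simp add: K_op_eq_K_flat)
  have F0: "F 0 = U" by (simp add: F_def sinkhorn_U_def)
  have G_eq: "G n = (\<lambda>y. V y + ln (K_flat lam W (\<lambda>x. exp (- F n x)) y))" for n
    by (simp add: F_def G_def sinkhorn_U_def sinkhorn_V_def split_beta)
  have F_Suc: "F (Suc n) = (\<lambda>x. U x + ln (K_op nu W (\<lambda>y. exp (- G n y)) x))" for n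
    by (simp add: F_def G_def sinkhorn_U_def sinkhorn_V_def split_beta)
  have F_Suc': "F (Suc n) = (\<lambda>x. U x + ln (K_flat nu (\<lambda>y x. W x y) (\<lambda>y. exp (- G n y)) x))" for n
    by (simp add: F_Suc K_op_eq_K_flat)
  have odd: "trans_odd lam nu U V W (2 * n + 1) = sinkhorn_kernel lam W (F n)" for n
    by (simp add: trans_odd_eq F_def sinkhorn_U_def split_beta)
  have even: "trans_even lam nu U V W (2 * Suc n) = sinkhorn_kernel nu (\<lambda>y x. W x y) (G n)" for n
    by (simp add: trans_even_eq G_def sinkhorn_V_def split_beta)
  have tF: "tame \<delta> U (F n)" and tG: "tame \<delta> V (G n)" for n
  proof -
    have "tame \<delta> V (G n)" if "tame \<delta> U (F n)" for n
      unfolding G_eq by (rule X.tame_next[OF that])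
    moreover have "tame \<delta> U (F n)"
      by (induction n) (auto simp: F0 F_Suc' X.tame_self intro: Y.tame_next calculation)
    ultimately show "tame \<delta> U (F n)" "tame \<delta> V (G n)" by auto
  qed
  have ga: "g_a = (\<lambda>x. 1/2 + a * exp (\<delta> * U x))" and ha: "h_a = (\<lambda>y. 1/2 + a * exp (\<delta> * V y))"
    using assms(3,4,8,9) by auto
  \<comment> \<open>\<open>e n\<close> is the weighted distance of the odd iterate of index
    \<open>2 * n + 1\<close> to \<mu>, and \<open>d n\<close> that of the even iterate of index
    \<open>2 * n + 2\<close> to \<eta>.\<close>
  define e where "e n = (\<integral>\<^sup>+x. ennreal \<bar>exp (- F n x) * K_op nu W (\<lambda>y. exp (- G n y)) x - exp (- U x)\<bar>
      * ennreal (1/2 + a * exp (\<delta> * U x)) \<partial>lam)" for n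
  define d where "d n = (\<integral>\<^sup>+y. ennreal \<bar>exp (- G n y) * K_flat lam W (\<lambda>x. exp (- F (Suc n) x)) y - exp (- V y)\<bar>
      * ennreal (1/2 + a * exp (\<delta> * V y)) \<partial>nu)" for n
  have lip_even: "lip g_a h_a (sinkhorn_kernel nu (\<lambda>y x. W x y) (G n)) \<le> ennreal \<rho>" for n
    using assms(10)[of "Suc n"] unfolding even by simp
  have lip_odd: "lip h_a g_a (sinkhorn_kernel lam W (F (Suc n))) \<le> ennreal \<rho>" for n
    using assms(10)[of "Suc n"] unfolding odd by simp
  have de: "d n \<le> ennreal \<rho> * e n" for n
    unfolding d_def e_def
    using Y.contraction[OF tF _ F_Suc' less_imp_le[OF assms(5)] lip_even[unfolded ga ha]] G_eq[of n]
    by (simp add: op K_op_eq_K_flat)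
  have ed: "e (Suc n) \<le> ennreal \<rho> * d n" for n
    unfolding d_def e_def
    by (rule X.contraction[OF tG F_Suc G_eq less_imp_le[OF assms(5)] lip_odd[unfolded ga ha]])
  have e_le: "e n \<le> ennreal (\<rho> ^ (2 * n)) * e 0" for n
  proof (induction n)
    case (Suc n)
    have "e (Suc n) \<le> ennreal \<rho> * (ennreal \<rho> * (ennreal (\<rho> ^ (2 * n)) * e 0))"
      using ed[of n] de[of n] Suc by (meson mult_left_mono order_trans zero_le)
    then show ?case using assms(6) by (simp add: mult.assoc[symmetric] ennreal_mult[symmetric])
  qed simp
  \<comment> \<open>The even side gains one more factor \<rho>, which is discarded to obtain the
    common rate.\<close>
  have d_le: "d n \<le> ennreal (\<rho> ^ (2 * n)) * e 0" for n
  proof -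
    have "ennreal \<rho> * e n \<le> 1 * e n" using assms(7) by (intro mult_right_mono) auto
    then show ?thesis using de[of n] e_le[of n] by simp
  qed
  \<comment> \<open>Without this the geometric bound would be vacuous. The first odd iterate and
    \<mu> both integrate the weight, and the difference of their densities is dominated by the
    sum.\<close>
  have "e 0 < \<infinity>"
  proof -
    note pi = X.sinkhorn_density[OF tF G_eq[of 0]]
    note [measurable] = pi(1)
    have "e 0 \<le> (\<integral>\<^sup>+x. ennreal (exp (- F 0 x) * K_op nu W (\<lambda>y. exp (- G 0 y)) x)
        * ennreal (1/2 + a * exp (\<delta> * U x))
        + ennreal (exp (- U x)) * ennreal (1/2 + a * exp (\<delta> * U x)) \<partial>lam)"
      unfolding e_def using pi(2)
      by (intro nn_integral_mono, subst distrib_right[symmetric], intro mult_right_mono)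
        (auto simp: abs_le_iff ennreal_plus[symmetric] add_increasing add_increasing2
          simp del: ennreal_plus intro!: ennreal_leI)
    also have "\<dots> = (\<integral>\<^sup>+x. ennreal (exp (- F 0 x) * K_op nu W (\<lambda>y. exp (- G 0 y)) x)
        * ennreal (1/2 + a * exp (\<delta> * U x)) \<partial>lam)
        + (\<integral>\<^sup>+x. ennreal (exp (- U x)) * ennreal (1/2 + a * exp (\<delta> * U x)) \<partial>lam)"
      by (rule nn_integral_add) measurable
    also have "\<dots> < \<infinity>"
      using pi(5)[OF less_imp_le[OF assms(5)]] X.gibbs_density(2)[of a] assms(5) by simp
    finally show ?thesis .
  qed
  then obtain r where r: "0 \<le> r" "e 0 = ennreal r" by (cases "e 0") auto
  \<comment> \<open>Using \<open>r + 1\<close> keeps the constant positive even when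
    \<open>e 0\<close> is 0.\<close>
  have bound: "ennreal (1 / a) * x \<le> ennreal ((r + 1) / a * \<rho> ^ (2 * n))"
    if "x \<le> ennreal (\<rho> ^ (2 * n)) * e 0" for x n
  proof -
    have "ennreal (1 / a) * x \<le> ennreal (1 / a) * (ennreal (\<rho> ^ (2 * n)) * e 0)"
      using that by (rule mult_left_mono) simp
    also have "\<dots> = ennreal (1 / a * (\<rho> ^ (2 * n) * r))"
      using r assms(5,6) by (simp add: ennreal_mult[symmetric])
    also have "\<dots> \<le> ennreal ((r + 1) / a * \<rho> ^ (2 * n))"
      using r assms(5,6) by (intro ennreal_leI) (simp add: field_simps)
    finally show ?thesis .
  qed
  have X_cost: "transport_cost \<psi>g (pi_odd lam nu U V W (2 * n + 1)) (gibbs lam U)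
      \<le> ennreal (1 / a) * e n" for n
    unfolding pi_odd_def odd e_def
    by (rule X.transport_cost_le[OF tF G_eq assms(5,11)]) (use assms(3,13) in auto)
  have Y_cost: "transport_cost \<psi>h (pi_even lam nu U V W (2 * (n + 1))) (gibbs nu V)
      \<le> ennreal (1 / a) * d n" for n
    using Y.transport_cost_le[OF tG F_Suc' assms(5,12)] assms(4,14) even[of n]
    by (simp add: pi_even_def d_def op)
  have "max (transport_cost \<psi>g (pi_odd lam nu U V W (2 * n + 1)) (gibbs lam U))
      (transport_cost \<psi>h (pi_even lam nu U V W (2 * (n + 1))) (gibbs nu V))
    \<le> ennreal ((r + 1) / a * \<rho> ^ (2 * n))" for n
    by (rule max.boundedI order_trans[OF X_cost bound[OF e_le]] order_trans[OF Y_cost bound[OF d_le]])+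
  then show ?thesis
    using r by (intro exI[of _ "r + 1"]) auto
qed

end
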